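(* Let $\mathcal{M}$ be a measure space which is a finite disjoint union $\mathcal{M}=\mathcal{X}_1\cup\cdots\cup\mathcal{X}_N$ of measurable sets with $|\mathcal{X}_j|=\omega_j>0$. Let $1\leqslant p,q\leqslant+\infty$ with $1/p+1/q=1$, and let $\Phi$ be a measurable kernel on $\mathcal{M}\times\mathcal{M}$ with $\{\int_{\mathcal{M}}|\Phi(x,y)|^q\,dy\}^{1/q}<+\infty$ for every $x$ and $\{\int_{\mathcal{M}}(\int_{\mathcal{M}}|\Phi(x,y)|\,dx)^q\,dy\}^{1/q}<+\infty$. Define \[ \Gamma(\Phi)=\sum_{j=1}^N\Big\{\int_{\mathcal{X}_j}\int_{\mathcal{M}}\Big|\int_{\mathcal{X}_j}\big(\Phi(x_j,y)-\Phi(z_j,y)\big)dz_j\Big|^q\,dy\,\frac{dx_j}{\omega_j}\Big\}^{1/q}, \] \[ \Delta(\Phi)=\Big\{\int_{\mathbf{X}}\int_{\mathcal{M}}\Big(\sum_{j=1}^N\Big|\int_{\mathcal{X}_j}\big(\Phi(x_j,y)-\Phi(z_j,y)\big)dz_j\Big|^2\Big)^{q/2}dy\,d\mathbf{x}\Big\}^{1/q}. \] Then for every $1\leqslant p\leqslant+\infty$, \[ \Big\{\int_{\mathbf{X}}\|\mathcal{E}_{\mathbf{x},\boldsymbol\omega}\|_{\Phi,p}^q\,d\mathbf{x}\Big\}^{1/q}\leqslant\Gamma(\Phi), \] and for every $1<p\leqslant+\infty$, \[ A(q)\,\Delta(\Phi)\leqslant\Big\{\int_{\mathbf{X}}\|\mathcal{E}_{\mathbf{x},\boldsymbol\omega}\|_{\Phi,p}^q\,d\mathbf{x}\Big\}^{1/q}\leqslant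 B(q)\,\Delta(\Phi). \] In particular, there exist choices of nodes $x_j\in\mathcal{X}_j$ such that for every $f\in\mathbb{H}^\Phi_p(\mathcal{M})$, $|\sum_{j=1}^N\omega_jf(x_j)-\int_{\mathcal{M}}f(x)dx|\leqslant\Gamma(\Phi)\|f\|_{\mathbb{H}^\Phi_p(\mathcal{M})}$ (for every $1\leqslant p\leqslant+\infty$), respectively $\leqslant B(q)\Delta(\Phi)\|f\|_{\mathbb{H}^\Phi_p(\mathcal{M})}$ (for every $1<p\leqslant+\infty$).
   Context: $\mathbf{X}=\mathcal{X}_1\times\cdots\times\mathcal{X}_N$, $\mathbf{x}=(x_1,\dots,x_N)$, with probability measure $d\mathbf{x}=\frac{dx_1}{\omega_1}\times\cdots\times\frac{dx_N}{\omega_N}$. $\mathbb{H}^\Phi_p(\mathcal{M})$ is the space of all potentials $f(x)=\int_{\mathcal{M}}\Phi(x,y)g(y)\,dy$, $g\in L^p(\mathcal{M})$, with norm $\inf\|g\|_{L^p}$ over all representing $g$. $\mathcal{E}_{\mathbf{x},\boldsymbol\omega}(f)=\sum_{j}\omega_jf(x_j)-\int_{\mathcal{M}}f$, and $\|\mathcal{E}_{\mathbf{x},\boldsymbol\omega}\|_{\Phi,p}=\sup_f|\mathcal{E}_{\mathbf{x},\boldsymbol\omega}(f)|/\|f\|_{\mathbb{H}^\Phi_p(\mathcal{M})}$. $A(q),B(q)$ are the best constants in the Marcinkiewicz--Zygmund inequality: for independent random variables $f_j$, $A(q)\{\mathbb{E}(\sum_j|f_j-\mathbb{E}f_j|^2)^{q/2}\}^{1/q}\leqslant\{\mathbb{E}|\sum_j(f_j-\mathbb{E}f_j)|^q\}^{1/q}\leqslant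 B(q)\{\mathbb{E}(\sum_j|f_j-\mathbb{E}f_j|^2)^{q/2}\}^{1/q}$ (for $1\leqslant q<+\infty$). *)

theory Defs
  imports "HOL-Probability.Probability"
begin

text \<open>Real power of an extended nonnegative real (used with positive exponents):
  infinity stays infinity.\<close>
definition epow :: "ennreal \<Rightarrow> real \<Rightarrow> ennreal" where
  "epow x r = (if x = \<infinity> then \<infinity> else ennreal (enn2real x powr r))"

definition lqnorm :: "'a measure \<Rightarrow> ereal \<Rightarrow> ('a \<Rightarrow> ennreal) \<Rightarrow> ennreal" where
  "lqnorm M q f = (if q = \<infinity> then esssup M f
     else epow (\<integral>\<^sup>+ x. epow (f x) (real_of_ereal q) \<partial>M) (1 / real_of_ereal q))"

definition in_Lp :: "'a measure \<Rightarrow> ereal \<Rightarrow> ('a \<Rightarrow> real) \<Rightarrow> bool" where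
  "in_Lp M p g \<longleftrightarrow> g \<in> borel_measurable M \<and> lqnorm M p (\<lambda>y. ennreal \<bar>g y\<bar>) < \<infinity>"

definition represents :: "'a measure \<Rightarrow> ('a \<Rightarrow> 'a \<Rightarrow> real) \<Rightarrow> ('a \<Rightarrow> real) \<Rightarrow> ('a \<Rightarrow> real) \<Rightarrow> bool" where
  "represents M Phi g f \<longleftrightarrow> (\<forall>x\<in>space M. f x = (\<integral>y. Phi x y * g y \<partial>M))"

definition Hspace :: "'a measure \<Rightarrow> ('a \<Rightarrow> 'a \<Rightarrow> real) \<Rightarrow> ereal \<Rightarrow> ('a \<Rightarrow> real) set" where
  "Hspace M Phi p = {f. \<exists>g. in_Lp M p g \<and> represents M Phi g f}"

definition Hnorm :: "'a measure \<Rightarrow> ('a \<Rightarrow> 'a \<Rightarrow> real) \<Rightarrow> ereal \<Rightarrow> ('a \<Rightarrow> real) \<Rightarrow> ennreal" where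
  "Hnorm M Phi p f = Inf {lqnorm M p (\<lambda>y. ennreal \<bar>g y\<bar>) | g. in_Lp M p g \<and> represents M Phi g f}"

definition qerr :: "'a measure \<Rightarrow> nat \<Rightarrow> (nat \<Rightarrow> real) \<Rightarrow> (nat \<Rightarrow> 'a) \<Rightarrow> ('a \<Rightarrow> real) \<Rightarrow> real" where
  "qerr M N \<omega> xs f = (\<Sum>j<N. \<omega> j * f (xs j)) - (\<integral>x. f x \<partial>M)"

text \<open>The operator norm of the error functional on H^Phi_p(M)
  (with 0/0 = 0, which only concerns f = 0).\<close>
definition errnorm :: "'a measure \<Rightarrow> ('a \<Rightarrow> 'a \<Rightarrow> real) \<Rightarrow> ereal \<Rightarrow> nat \<Rightarrow> (nat \<Rightarrow> real) \<Rightarrow> (nat \<Rightarrow> 'a) \<Rightarrow> ennreal" where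
  "errnorm M Phi p N \<omega> xs = (SUP f \<in> Hspace M Phi p. ennreal \<bar>qerr M N \<omega> xs f\<bar> / Hnorm M Phi p f)"

definition piece :: "'a measure \<Rightarrow> ('b \<Rightarrow> 'a set) \<Rightarrow> ('b \<Rightarrow> real) \<Rightarrow> 'b \<Rightarrow> 'a measure" where
  "piece M X \<omega> j = scale_measure (ennreal (1 / \<omega> j)) (restrict_space M (X j))"

definition nodes_measure :: "'a measure \<Rightarrow> nat \<Rightarrow> (nat \<Rightarrow> 'a set) \<Rightarrow> (nat \<Rightarrow> real) \<Rightarrow> (nat \<Rightarrow> 'a) measure" where
  "nodes_measure M N X \<omega> = (\<Pi>\<^sub>M j\<in>{..<N}. piece M X \<omega> j)"

definition dPhi :: "'a measure \<Rightarrow> ('a \<Rightarrow> 'a \<Rightarrow> real) \<Rightarrow> 'a set \<Rightarrow> 'a \<Rightarrow> 'a \<Rightarrow> real" where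
  "dPhi M Phi S x y = (LINT z:S|M. (Phi x y - Phi z y))"

definition Gamma :: "'a measure \<Rightarrow> ('a \<Rightarrow> 'a \<Rightarrow> real) \<Rightarrow> ereal \<Rightarrow> nat \<Rightarrow> (nat \<Rightarrow> 'a set) \<Rightarrow> (nat \<Rightarrow> real) \<Rightarrow> ennreal" where
  "Gamma M Phi q N X \<omega> = (\<Sum>j<N. lqnorm (piece M X \<omega> j \<Otimes>\<^sub>M M) q
       (\<lambda>(x, y). ennreal \<bar>dPhi M Phi (X j) x y\<bar>))"

definition Delta :: "'a measure \<Rightarrow> ('a \<Rightarrow> 'a \<Rightarrow> real) \<Rightarrow> ereal \<Rightarrow> nat \<Rightarrow> (nat \<Rightarrow> 'a set) \<Rightarrow> (nat \<Rightarrow> real) \<Rightarrow> ennreal" where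
  "Delta M Phi q N X \<omega> = lqnorm (nodes_measure M N X \<omega> \<Otimes>\<^sub>M M) q
       (\<lambda>(xs, y). ennreal (sqrt (\<Sum>j<N. \<bar>dPhi M Phi (X j) (xs j) y\<bar> ^ 2)))"

text \<open>Marcinkiewicz--Zygmund inequalities with constants c (lower) and C (upper), exponent
  1 <= q < infinity, for finite families of independent real random variables with finite
  q-th moments.  Probability spaces are taken on the type nat => real; every finite
  independent family on an arbitrary probability space has the same joint law as the
  coordinate family on a product space of this type, so the best constants are the same.\<close>
definition mz_family :: "real \<Rightarrow> (nat \<Rightarrow> real) measure \<Rightarrow> nat \<Rightarrow> (nat \<Rightarrow> (nat \<Rightarrow> real) \<Rightarrow> real) \<Rightarrow> bool" where
  "mz_family q P n f \<longleftrightarrow> prob_space P \<and> prob_space.indep_vars P (\<lambda>_. borel) f {..<n} \<and>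
     (\<forall>j<n. integrable P (f j) \<and> integrable P (\<lambda>\<xi>. \<bar>f j \<xi>\<bar> powr q))"

definition mz_lhs :: "real \<Rightarrow> (nat \<Rightarrow> real) measure \<Rightarrow> nat \<Rightarrow> (nat \<Rightarrow> (nat \<Rightarrow> real) \<Rightarrow> real) \<Rightarrow> real" where
  "mz_lhs q P n f = (\<integral>\<xi>. \<bar>\<Sum>j<n. f j \<xi> - (\<integral>\<eta>. f j \<eta> \<partial>P)\<bar> powr q \<partial>P) powr (1 / q)"

definition mz_rhs :: "real \<Rightarrow> (nat \<Rightarrow> real) measure \<Rightarrow> nat \<Rightarrow> (nat \<Rightarrow> (nat \<Rightarrow> real) \<Rightarrow> real) \<Rightarrow> real" where
  "mz_rhs q P n f = (\<integral>\<xi>. (\<Sum>j<n. \<bar>f j \<xi> - (\<integral>\<eta>. f j \<eta> \<partial>P)\<bar>\<^sup>2) powr (q / 2) \<partial>P) powr (1 / q)"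

definition MZ_A :: "real \<Rightarrow> real" where
  "MZ_A q = Sup {c. \<forall>P n f. mz_family q P n f \<longrightarrow> c * mz_rhs q P n f \<le> mz_lhs q P n f}"

definition MZ_B :: "real \<Rightarrow> real" where
  "MZ_B q = Inf {C. \<forall>P n f. mz_family q P n f \<longrightarrow> mz_lhs q P n f \<le> C * mz_rhs q P n f}"

end

theory Submission
  imports Defs
begin

text \<open>If \<open>f\<close> is the potential of \<open>g\<close>, Fubini gives \<open>qerr f = \<integral> K xs y * g y dy\<close> with
  \<open>K xs y = (\<Sum>j<N. dPhi (X j) (xs j) y)\<close>, so by the duality of \<open>L\<^sup>p\<close> and \<open>L\<^sup>q\<close> the norm of the error
  functional is the \<open>L\<^sup>q\<close> norm of \<open>K xs\<close>. For almost every \<open>y\<close> the summands of \<open>K xs y\<close> are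
  independent functions of \<open>xs\<close> with mean zero. Minkowski's inequality gives \<open>Gamma\<close>; applying the
  Marcinkiewicz--Zygmund inequality for each fixed \<open>y\<close> and integrating gives \<open>Delta\<close>. Since \<open>MZ_B\<close> is
  an infimum in \<open>real\<close>, its inequality is only available once some upper constant is known to exist,
  so the upper Marcinkiewicz--Zygmund inequality is proved from Khinchine's inequality.\<close>

section \<open>Lebesgue norms with values in the extended nonnegative reals\<close>

text \<open>The constants \<open>MZ_A\<close> and \<open>MZ_B\<close> speak of families with finite
  q-th moments on the type \<open>nat \<Rightarrow> real\<close>. For fixed \<open>y\<close> the
  summands of \<open>K xs y\<close> live on the space of nodes, and their q-th moments may be
  infinite. Two devices close this gap: passing to the joint law, which moves a family to the
  required type, and an extension to integrals in \<open>ennreal\<close>, where an infinite moment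
  makes the larger side of the inequality infinite. For \<open>MZ_A\<close>, the constant 0 is
  always admissible, and a fair sign bounds the admissible constants from above. The two
  integrability conditions on \<Phi> act differently. Finite rows, together with the column
  condition, put \<open>K xs\<close> in \<open>L\<^sup>q\<close> for every choice of nodes, so that
  duality applies everywhere. The column condition also makes almost every section
  \<open>\<lambda>z. \<Phi> z y\<close> integrable and justifies Fubini. The exponent p = 1 belongs
  to q = \<infinity>, outside the range of the Marcinkiewicz--Zygmund constants, while Minkowski's
  inequality still holds for the essential supremum.\<close>

lemma epow_ennreal [simp]: "0 \<le> x \<Longrightarrow> epow (ennreal x) r = ennreal (x powr r)"
  by (simp add: epow_def)

lemma epow_top [simp]: "epow \<infinity> r = \<infinity>" "epow top r = top"
  by (simp_all add: epow_def)

lemma epow_zero [simp]: "epow 0 r = 0"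
  by (simp add: epow_def)

lemma epow_one [simp]: "epow x 1 = x"
  by (cases x) (auto simp: epow_def)

lemma epow_eq_top_iff [simp]: "epow x r = top \<longleftrightarrow> x = top"
  by (simp add: epow_def)

lemma epow_eq_0_iff [simp]: "epow x r = 0 \<longleftrightarrow> x = 0"
  by (cases x) (auto simp: epow_def ennreal_eq_0_iff)

lemma epow_mono: "0 \<le> r \<Longrightarrow> x \<le> y \<Longrightarrow> epow x r \<le> epow y r"
  by (cases x; cases y) (auto simp: epow_def top_unique intro!: ennreal_leI powr_mono2)

lemma epow_epow [simp]: "epow (epow x r) s = epow x (r * s)"
  by (cases x) (auto simp: epow_def powr_powr)

lemma epow_mult: "epow (x * y) r = epow x r * epow y r"
  by (cases x; cases y)
    (auto simp: epow_def powr_mult ennreal_mult[symmetric] ennreal_mult_eq_top_iff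
      ennreal_top_mult ennreal_mult_top enn2real_mult)

lemma measurable_epow [measurable]:
  assumes [measurable]: "f \<in> borel_measurable M"
  shows "(\<lambda>x. epow (f x) r) \<in> borel_measurable M"
  unfolding epow_def by measurable

lemma lqnorm_real: "lqnorm M (ereal r) f = epow (\<integral>\<^sup>+ x. epow (f x) r \<partial>M) (1 / r)"
  by (simp add: lqnorm_def)

lemma lqnorm_infty: "lqnorm M \<infinity> f = esssup M f"
  by (simp add: lqnorm_def)

lemma epow_lqnorm: "0 < r \<Longrightarrow> epow (lqnorm M (ereal r) f) r = (\<integral>\<^sup>+ x. epow (f x) r \<partial>M)"
  by (simp add: lqnorm_real)

lemma ereal_ge_1_cases:
  assumes "1 \<le> (q::ereal)"
  obtains r where "q = ereal r" "1 \<le> r" | "q = \<infinity>"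
  using assms by (cases q) auto

lemma lqnorm_mono_AE:
  assumes "1 \<le> q" "AE x in M. f x \<le> g x" "f \<in> borel_measurable M"
  shows "lqnorm M q f \<le> lqnorm M q g"
  using assms(1)
proof (cases q rule: ereal_ge_1_cases)
  case (1 r)
  show ?thesis
    unfolding 1 lqnorm_real using assms(2) 1
    by (intro epow_mono nn_integral_mono_AE) (auto elim!: eventually_mono intro: epow_mono)
next
  case 2
  then show ?thesis
    using assms by (simp add: lqnorm_infty esssup_AE_mono)
qed

lemma lqnorm_cong: "(\<And>x. x \<in> space M \<Longrightarrow> f x = g x) \<Longrightarrow> lqnorm M q f = lqnorm M q g"
  unfolding lqnorm_def
  by (auto intro!: arg_cong2[where f=epow] nn_integral_cong esssup_AE_cong
      simp: esssup_def measurable_cong[of M f g] intro!: Limsup_eq AE_I2)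

lemma lqnorm_finite_AE:
  assumes "1 \<le> q" "f \<in> borel_measurable M" "lqnorm M q f < \<infinity>"
  shows "AE x in M. f x < \<infinity>"
  using assms(1)
proof (cases q rule: ereal_ge_1_cases)
  case (1 r)
  have "(\<integral>\<^sup>+ x. epow (f x) r \<partial>M) \<noteq> \<infinity>"
    using assms(3) by (auto simp: 1 lqnorm_real)
  then have "AE x in M. epow (f x) r \<noteq> \<infinity>"
    using assms(2) by (intro nn_integral_PInf_AE) auto
  then show ?thesis
    by (auto simp: less_top)
next
  case 2
  show ?thesis
    using esssup_AE[where M=M and f=f] assms(3) unfolding 2 lqnorm_infty
    by (auto elim!: eventually_mono)
qed

lemma lqnorm_distr:
  assumes [measurable]: "T \<in> measurable M N" "f \<in> borel_measurable N" and "1 \<le> q"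
  shows "lqnorm (distr M N T) q f = lqnorm M q (\<lambda>x. f (T x))"
  using assms(3)
proof (cases q rule: ereal_ge_1_cases)
  case (1 r)
  then show ?thesis by (simp add: lqnorm_real nn_integral_distr)
next
  case 2
  show ?thesis
    by (simp add: 2 lqnorm_infty esssup_eq_AE AE_distr_iff)
qed

section \<open>Hoelder's inequality for functions with values in \<open>ennreal\<close>\<close>

lemma Hoelder_aux:
  assumes ab: "1 < a" "1 < b" "1 / a + 1 / b = (1::real)"
    and [measurable]: "f \<in> borel_measurable M" "g \<in> borel_measurable M"
  shows "(\<integral>\<^sup>+ x. f x * g x \<partial>M) \<le> lqnorm M (ereal a) f * lqnorm M (ereal b) g"
proof -
  define F where "F = (\<integral>\<^sup>+ x. epow (f x) a \<partial>M)"
  define G where "G = (\<integral>\<^sup>+ x. epow (g x) b \<partial>M)"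
  \<comment> \<open>A vanishing norm must be settled first: the other norm may be infinite, and the
    product is then still 0.\<close>
  consider "F = 0 \<or> G = 0" | "F \<noteq> 0" "G \<noteq> 0" "F = \<infinity> \<or> G = \<infinity>"
    | "F \<noteq> 0" "G \<noteq> 0" "F \<noteq> \<infinity>" "G \<noteq> \<infinity>" by blast
  then show ?thesis
  proof cases
    case 1
    then have "(AE x in M. f x = 0) \<or> (AE x in M. g x = 0)"
      unfolding F_def G_def by (auto simp: nn_integral_0_iff_AE)
    then have "AE x in M. f x * g x = 0"
      by (auto elim!: eventually_mono)
    then have "(\<integral>\<^sup>+ x. f x * g x \<partial>M) = 0"
      by (subst nn_integral_0_iff_AE) auto
    then show ?thesis by simp
  next
    case 2
    then have "lqnorm M (ereal a) f * lqnorm M (ereal b) g = \<infinity>"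
      unfolding lqnorm_real F_def[symmetric] G_def[symmetric]
      by (auto simp: ennreal_mult_eq_top_iff)
    then show ?thesis by simp
  next
    case 3
    define u where "u = enn2real F powr (1 / a)"
    define v where "v = enn2real G powr (1 / b)"
    have Fu: "F = ennreal (u powr a)" and Gv: "G = ennreal (v powr b)"
      using 3 ab by (simp_all add: u_def v_def powr_powr less_top)
    have uv: "u > 0" "v > 0"
      using 3 unfolding u_def v_def by (auto simp: enn2real_eq_0_iff)
    have fin: "AE x in M. epow (f x) a \<noteq> \<infinity>" "AE x in M. epow (g x) b \<noteq> \<infinity>"
      using 3(3,4) unfolding F_def G_def by (intro nn_integral_PInf_AE; simp)+
    \<comment> \<open>Young's inequality for s/u and t/v, multiplied by u * v. After integration the
      two terms become u * v / a and u * v / b, which add up to u * v.\<close>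
    have young: "s * t \<le> u * v / (a * u powr a) * s powr a + u * v / (b * v powr b) * t powr b"
      if "0 \<le> s" "0 \<le> t" for s t
    proof -
      have "(s / u) * (t / v) \<le> (s / u) powr a / a + (t / v) powr b / b"
        using that uv ab by (intro Youngs_inequality) auto
      then have "u * v * ((s / u) * (t / v)) \<le> u * v * ((s / u) powr a / a + (t / v) powr b / b)"
        using uv by (intro mult_left_mono) auto
      also have "\<dots> = u * v / (a * u powr a) * s powr a + u * v / (b * v powr b) * t powr b"
        using that uv by (simp add: powr_divide field_simps)
      finally show ?thesis using uv by simp
    qed
    have "(\<integral>\<^sup>+ x. f x * g x \<partial>M)
        \<le> (\<integral>\<^sup>+ x. ennreal (u * v / (a * u powr a)) * epow (f x) a
               + ennreal (u * v / (b * v powr b)) * epow (g x) b \<partial>M)"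
    proof (intro nn_integral_mono_AE, use fin in eventually_elim)
      fix x assume "epow (f x) a \<noteq> \<infinity>" "epow (g x) b \<noteq> \<infinity>"
      then obtain s t where st: "f x = ennreal s" "g x = ennreal t" "0 \<le> s" "0 \<le> t"
        by (cases "f x"; cases "g x") auto
      show "f x * g x \<le> ennreal (u * v / (a * u powr a)) * epow (f x) a
               + ennreal (u * v / (b * v powr b)) * epow (g x) b"
        using young[of s t] st uv ab
        by (simp add: ennreal_mult[symmetric] ennreal_plus[symmetric] ennreal_leI del: ennreal_plus)
    qed
    also have "\<dots> = ennreal (u * v / (a * u powr a)) * F + ennreal (u * v / (b * v powr b)) * G"
      by (simp add: nn_integral_add nn_integral_cmult F_def G_def)
    also have "\<dots> = ennreal (u * v * (1 / a + 1 / b))"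
      unfolding Fu Gv using uv ab
      by (simp add: ennreal_mult[symmetric] ennreal_plus[symmetric] field_simps del: ennreal_plus)
    also have "\<dots> = lqnorm M (ereal a) f * lqnorm M (ereal b) g"
      unfolding lqnorm_real F_def[symmetric] G_def[symmetric] Fu Gv using uv ab
      by (simp add: powr_powr ennreal_mult[symmetric])
    finally show ?thesis .
  qed
qed

lemma conjugate_exponents_cases:
  assumes "1 \<le> p" "1 \<le> q" "1 / p + 1 / q = (1::ereal)"
  obtains a b where "p = ereal a" "q = ereal b" "1 < a" "1 < b" "1 / a + 1 / b = 1"
    | "p = 1" "q = \<infinity>" | "p = \<infinity>" "q = 1"
proof (cases rule: ereal_ge_1_cases[OF assms(1)])
  case p: (1 a)
  show ?thesis
  proof (cases rule: ereal_ge_1_cases[OF assms(2)])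
    case q: (1 b)
    have "1 / a + 1 / b = 1"
      using assms(3) p q by (simp add: one_ereal_def)
    moreover from this have "a \<noteq> 1" "b \<noteq> 1" using p q by auto
    ultimately show ?thesis using p q that(1) by auto
  next
    case 2
    then show ?thesis using assms(3) p that(2) by (auto simp: one_ereal_def)
  qed
next
  case p: 2
  then show ?thesis using assms that(3) by (cases rule: ereal_ge_1_cases[OF assms(2)]) (auto simp: one_ereal_def)
qed

lemma lqnorm_1: "lqnorm M 1 f = (\<integral>\<^sup>+ x. f x \<partial>M)"
  unfolding one_ereal_def lqnorm_real by simp

lemma Hoelder:
  assumes "1 \<le> p" "1 \<le> q" "1 / p + 1 / q = (1::ereal)"
    and [measurable]: "f \<in> borel_measurable M" "g \<in> borel_measurable M"
  shows "(\<integral>\<^sup>+ x. f x * g x \<partial>M) \<le> lqnorm M p f * lqnorm M q g"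
proof (cases rule: conjugate_exponents_cases[OF assms(1-3)])
  case (1 a b)
  then show ?thesis using Hoelder_aux[of a b, where f=f and g=g and M=M] by simp
next
  case 2
  have "(\<integral>\<^sup>+ x. f x * g x \<partial>M) \<le> (\<integral>\<^sup>+ x. f x * esssup M g \<partial>M)"
    using esssup_AE[where M=M and f=g] by (intro nn_integral_mono_AE) (auto elim!: eventually_mono intro: mult_left_mono)
  then show ?thesis using 2 by (simp add: lqnorm_1 lqnorm_infty nn_integral_multc)
next
  case 3
  have "(\<integral>\<^sup>+ x. f x * g x \<partial>M) \<le> (\<integral>\<^sup>+ x. esssup M f * g x \<partial>M)"
    using esssup_AE[where M=M and f=f] by (intro nn_integral_mono_AE) (auto elim!: eventually_mono intro: mult_right_mono)
  then show ?thesis using 3 by (simp add: lqnorm_1 lqnorm_infty nn_integral_cmult)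
qed

section \<open>Convexity of powers and Minkowski's inequality\<close>

text \<open>This is the tangent line of the convex function s^q at t, rearranged; it comes from
  Young's inequality with exponents q and q / (q - 1), which needs q > 1.\<close>

lemma powr_tangent:
  assumes "1 \<le> q" "0 \<le> s" "0 \<le> (t::real)"
  shows "q * s * t powr (q - 1) \<le> s powr q + (q - 1) * t powr q"
proof (cases "q = 1")
  case True
  then show ?thesis using assms by (auto simp: powr_def)
next
  case False
  then have q: "1 < q" using assms by simp
  have e: "(q - 1) * (q / (q - 1)) = q" using q by simp
  have "s * t powr (q - 1) \<le> s powr q / q + (t powr (q - 1)) powr (q / (q - 1)) / (q / (q - 1))"
    using q assms by (intro Youngs_inequality) (auto simp: field_simps)
  also have "\<dots> = (s powr q + (q - 1) * t powr q) / q"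
    unfolding powr_powr e using q by (simp add: field_simps)
  finally show ?thesis
    using q by (simp add: field_simps)
qed

text \<open>The tangent at the mean \<open>w\<close> is evaluated at \<open>s\<close> and
  \<open>t\<close> and averaged; the terms in \<open>w\<close> then combine to a single
  power.\<close>

lemma powr_convex:
  assumes "1 \<le> q" "0 \<le> s" "0 \<le> t" "0 \<le> l" "0 \<le> m" "l + m = (1::real)"
  shows "(l * s + m * t) powr q \<le> l * s powr q + m * t powr q"
proof -
  define w where "w = l * s + m * t"
  have w: "0 \<le> w" using assms by (simp add: w_def)
  have "q * w powr q = l * (q * s * w powr (q - 1)) + m * (q * t * w powr (q - 1))"
  proof -
    have "w powr q = w * w powr (q - 1)"
      using w by (cases "w = 0") (auto simp: powr_diff)
    then show ?thesis by (simp add: w_def algebra_simps)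
  qed
  also have "\<dots> \<le> l * (s powr q + (q - 1) * w powr q) + m * (t powr q + (q - 1) * w powr q)"
    using assms w by (intro add_mono mult_left_mono powr_tangent) auto
  also have "\<dots> = l * s powr q + m * t powr q + (l + m) * (q - 1) * w powr q"
    by (simp add: algebra_simps)
  finally show ?thesis using assms by (simp add: w_def algebra_simps)
qed

text \<open>(f + g) / (a + b) is a convex combination of f / a and g / b, with weights a / (a + b)
  and b / (a + b). Positive upper bounds stand in for the norms so that these divisions make sense
  even when a norm is 0; \<open>lqnorm_add\<close> removes the slack by an epsilon.\<close>

lemma lqnorm_add_aux:
  assumes r: "1 \<le> r"
    and [measurable]: "f \<in> borel_measurable M" "g \<in> borel_measurable M"
    and a: "lqnorm M (ereal r) f \<le> ennreal a" "0 < a"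
    and b: "lqnorm M (ereal r) g \<le> ennreal b" "0 < b"
  shows "lqnorm M (ereal r) (\<lambda>x. f x + g x) \<le> ennreal (a + b)"
proof -
  have F: "(\<integral>\<^sup>+ x. epow (f x) r \<partial>M) \<le> ennreal (a powr r)"
    using epow_mono[of r, OF _ a(1)] r a by (simp add: epow_lqnorm)
  have G: "(\<integral>\<^sup>+ x. epow (g x) r \<partial>M) \<le> ennreal (b powr r)"
    using epow_mono[of r, OF _ b(1)] r b by (simp add: epow_lqnorm)
  define l where "l = (a + b) powr r * (a / (a + b)) / a powr r"
  define m where "m = (a + b) powr r * (b / (a + b)) / b powr r"
  have lm: "0 \<le> l" "0 \<le> m" using a b by (auto simp: l_def m_def)
  have conv: "(s + t) powr r \<le> l * s powr r + m * t powr r" if "0 \<le> s" "0 \<le> t" for s t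
  proof -
    have "s + t = (a + b) * (a / (a + b) * (s / a) + b / (a + b) * (t / b))"
      using a b by (simp add: add_divide_distrib[symmetric])
    then have "(s + t) powr r = (a + b) powr r * (a / (a + b) * (s / a) + b / (a + b) * (t / b)) powr r"
      using a b that by (metis powr_mult)
    also have "\<dots> \<le> (a + b) powr r * (a / (a + b) * (s / a) powr r + b / (a + b) * (t / b) powr r)"
      using a b that r by (intro mult_left_mono powr_convex) (auto simp: add_divide_distrib[symmetric])
    also have "\<dots> = l * s powr r + m * t powr r"
      using a b that by (simp add: l_def m_def powr_divide algebra_simps)
    finally show ?thesis .
  qed
  have "(\<integral>\<^sup>+ x. epow (f x + g x) r \<partial>M)
      \<le> (\<integral>\<^sup>+ x. ennreal l * epow (f x) r + ennreal m * epow (g x) r \<partial>M)"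
  proof (rule nn_integral_mono)
    fix x
    have lm': "l > 0" "m > 0" using a b by (auto simp: l_def m_def)
    show "epow (f x + g x) r \<le> ennreal l * epow (f x) r + ennreal m * epow (g x) r"
    proof (cases "f x = top \<or> g x = top")
      case True
      then show ?thesis using lm' by (auto simp: ennreal_mult_top)
    next
      case False
      then obtain s t where "f x = ennreal s" "g x = ennreal t" "0 \<le> s" "0 \<le> t"
        by (cases "f x"; cases "g x") auto
      then show ?thesis using conv[of s t] lm
        by (simp add: ennreal_mult[symmetric] ennreal_plus[symmetric] ennreal_leI del: ennreal_plus)
    qed
  qed
  also have "\<dots> = ennreal l * (\<integral>\<^sup>+ x. epow (f x) r \<partial>M) + ennreal m * (\<integral>\<^sup>+ x. epow (g x) r \<partial>M)"
    by (simp add: nn_integral_add nn_integral_cmult)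
  also have "\<dots> \<le> ennreal l * ennreal (a powr r) + ennreal m * ennreal (b powr r)"
    using F G by (intro add_mono mult_left_mono) auto
  also have "\<dots> = ennreal (l * a powr r + m * b powr r)"
    using lm by (simp add: ennreal_mult)
  also have "l * a powr r + m * b powr r = (a + b) powr r * (a / (a + b) + b / (a + b))"
    using a b by (simp add: l_def m_def distrib_left)
  also have "\<dots> = (a + b) powr r"
    using a b by (simp add: add_divide_distrib[symmetric])
  finally have "epow (\<integral>\<^sup>+ x. epow (f x + g x) r \<partial>M) (1 / r) \<le> epow (ennreal ((a + b) powr r)) (1 / r)"
    using r by (intro epow_mono) auto
  then show ?thesis
    using r a b by (simp add: lqnorm_real powr_powr)
qed

lemma lqnorm_add:
  assumes q: "1 \<le> q" and [measurable]: "f \<in> borel_measurable M" "g \<in> borel_measurable M"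
  shows "lqnorm M q (\<lambda>x. f x + g x) \<le> lqnorm M q f + lqnorm M q g"
  using q
proof (cases q rule: ereal_ge_1_cases)
  case (1 r)
  show ?thesis
  proof (cases "lqnorm M q f = top \<or> lqnorm M q g = top")
    case False
    then obtain s t where st: "lqnorm M q f = ennreal s" "lqnorm M q g = ennreal t" "0 \<le> s" "0 \<le> t"
      by (cases "lqnorm M q f"; cases "lqnorm M q g") auto
    show ?thesis
    proof (rule ennreal_le_epsilon)
      fix e :: real assume e: "0 < e"
      have "lqnorm M q (\<lambda>x. f x + g x) \<le> ennreal ((s + e / 2) + (t + e / 2))"
        unfolding 1 using st e 1 by (intro lqnorm_add_aux) (auto intro!: ennreal_leI)
      also have "\<dots> = lqnorm M q f + lqnorm M q g + ennreal e"
        using st e by (simp add: ennreal_plus[symmetric] del: ennreal_plus)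
      finally show "lqnorm M q (\<lambda>x. f x + g x) \<le> lqnorm M q f + lqnorm M q g + ennreal e" .
    qed
  qed auto
next
  case 2
  show ?thesis
    unfolding 2 lqnorm_infty using esssup_AE[where M=M and f=f] esssup_AE[where M=M and f=g]
    by (intro esssup_I) (auto elim!: eventually_elim2 intro: add_mono)
qed

lemma lqnorm_zero [simp]: "1 \<le> q \<Longrightarrow> lqnorm M q (\<lambda>x. 0) = 0"
  by (cases q rule: ereal_ge_1_cases)
    (auto simp: lqnorm_real lqnorm_infty intro!: antisym esssup_I)

lemma lqnorm_sum:
  assumes q: "1 \<le> q" and "finite I" and "\<And>i. i \<in> I \<Longrightarrow> f i \<in> borel_measurable M"
  shows "lqnorm M q (\<lambda>x. \<Sum>i\<in>I. f i x) \<le> (\<Sum>i\<in>I. lqnorm M q (f i))"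
  using assms(2,3)
proof (induction rule: finite_induct)
  case empty
  then show ?case using q by simp
next
  case (insert i I)
  then have "lqnorm M q (\<lambda>x. \<Sum>i\<in>insert i I. f i x) \<le> lqnorm M q (f i) + lqnorm M q (\<lambda>x. \<Sum>i\<in>I. f i x)"
    using lqnorm_add[OF q, where f="f i" and M=M and g="\<lambda>x. \<Sum>i\<in>I. f i x"] by simp
  also have "\<dots> \<le> lqnorm M q (f i) + (\<Sum>i\<in>I. lqnorm M q (f i))"
    using insert by (intro add_left_mono) auto
  finally show ?case using insert by simp
qed

lemma lqnorm_cmult_le:
  assumes q: "1 \<le> q" and [measurable]: "f \<in> borel_measurable M"
  shows "lqnorm M q (\<lambda>x. c * f x) \<le> c * lqnorm M q f"
  using q
proof (cases q rule: ereal_ge_1_cases)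
  case (1 r)
  then show ?thesis
    by (simp add: lqnorm_real epow_mult nn_integral_cmult)
next
  case 2
  show ?thesis
    unfolding 2 lqnorm_infty using esssup_AE[where M=M and f=f]
    by (intro esssup_I) (auto elim!: eventually_mono intro: mult_left_mono)
qed

text \<open>A function larger than its \<open>L\<^sup>q\<close> mean at every point of a probability
  space would have a mean larger than itself. This is what turns a bound averaged over the nodes
  into the existence of good nodes.\<close>

lemma (in prob_space) exists_le_lqnorm:
  assumes "1 \<le> q" and F [measurable]: "F \<in> borel_measurable M"
  shows "\<exists>x\<in>space M. F x \<le> lqnorm M q F"
  using assms(1)
proof (cases q rule: ereal_ge_1_cases)
  case (1 r)
  define I where "I = (\<integral>\<^sup>+ x. epow (F x) r \<partial>M)"
  have "\<exists>x\<in>space M. epow (F x) r \<le> I"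
  proof (rule ccontr)
    assume "\<not> ?thesis"
    then have gt: "I < epow (F x) r" if "x \<in> space M" for x
      using that by auto
    then have "I \<noteq> \<infinity>" using not_empty by (metis all_not_in_conv infinity_ennreal_def not_top_less)
    have "(\<integral>\<^sup>+ x. I \<partial>M) < (\<integral>\<^sup>+ x. epow (F x) r \<partial>M)"
    proof (rule nn_integral_less)
      show "(\<integral>\<^sup>+ x. I \<partial>M) \<noteq> \<infinity>" using \<open>I \<noteq> \<infinity>\<close> by (simp add: emeasure_space_1)
      show "AE x in M. I \<le> epow (F x) r" using gt by (intro AE_I2) (auto intro: less_imp_le)
      have "AE x in M. \<not> (epow (F x) r \<le> I)" using gt by (intro AE_I2) (auto simp: not_le)
      then show "\<not> (AE x in M. epow (F x) r \<le> I)"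
        by (auto dest: AE_contr)
    qed auto
    then show False by (simp add: I_def emeasure_space_1)
  qed
  then obtain x where x: "x \<in> space M" "epow (F x) r \<le> I" by blast
  then have "epow (epow (F x) r) (1 / r) \<le> lqnorm M q F"
    unfolding 1 lqnorm_real I_def using 1 by (intro epow_mono) auto
  then show ?thesis using 1 x by auto
next
  case 2
  show ?thesis
  proof (rule ccontr)
    assume *: "\<not> ?thesis"
    have "AE x in M. \<not> (F x \<le> lqnorm M q F)" using * by (intro AE_I2) auto
    moreover have "AE x in M. F x \<le> lqnorm M q F"
      unfolding 2 lqnorm_infty by (rule esssup_AE)
    ultimately show False using AE_contr[of "\<lambda>x. F x \<le> lqnorm M q F"] by auto
  qed
qed

text \<open>For finite q the extremal function of Hoelder's inequality attains the norm. For q =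
  \<infinity> the norm need not be attained, hence the arbitrary \<open>t\<close> below it;
  \<open>g\<close> is then the sign of \<open>K\<close> on the set where |K| exceeds
  \<open>t\<close>, which has finite measure.\<close>

lemma (in finite_measure) lqnorm_duality:
  assumes pq: "1 \<le> p" "1 \<le> q" "1 / p + 1 / q = (1::ereal)"
    and K [measurable]: "K \<in> borel_measurable M"
    and fin: "lqnorm M q (\<lambda>y. ennreal \<bar>K y\<bar>) < \<infinity>"
    and t: "t < lqnorm M q (\<lambda>y. ennreal \<bar>K y\<bar>)"
  obtains g where "in_Lp M p g" "lqnorm M p (\<lambda>y. ennreal \<bar>g y\<bar>) \<noteq> 0"
    "t * lqnorm M p (\<lambda>y. ennreal \<bar>g y\<bar>) \<le> ennreal (\<integral>y. K y * g y \<partial>M)"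
  using pq(2)
proof (cases q rule: ereal_ge_1_cases)
  case (1 r)
  define \<kappa> where "\<kappa> = enn2real (lqnorm M q (\<lambda>y. ennreal \<bar>K y\<bar>))"
  have k: "lqnorm M q (\<lambda>y. ennreal \<bar>K y\<bar>) = ennreal \<kappa>"
    using fin by (simp add: \<kappa>_def)
  have k0: "\<kappa> > 0"
    using t k by (cases "\<kappa> > 0") (auto simp: ennreal_neg)
  have I: "(\<integral>\<^sup>+ y. ennreal (\<bar>K y\<bar> powr r) \<partial>M) = ennreal (\<kappa> powr r)"
    using epow_lqnorm[of r M "\<lambda>y. ennreal \<bar>K y\<bar>"] k 1 k0 by simp
  \<comment> \<open>Chosen so that K * g = |K|^r. At zeros of \<open>K\<close> the function
    \<open>g\<close> vanishes even for r = 1.\<close>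
  define g where "g y = sgn (K y) * \<bar>K y\<bar> powr (r - 1)" for y
  have [measurable]: "g \<in> borel_measurable M" unfolding g_def by measurable
  have Kg: "K y * g y = \<bar>K y\<bar> powr r" for y
    by (cases "K y = 0") (auto simp: g_def sgn_if powr_diff)
  have "integrable M (\<lambda>y. \<bar>K y\<bar> powr r)"
    using I by (intro integrableI_bounded) auto
  then have int: "ennreal (\<integral>y. K y * g y \<partial>M) = ennreal (\<kappa> powr r)"
    unfolding Kg using I by (subst nn_integral_eq_integral[symmetric]) auto
  have ng: "lqnorm M p (\<lambda>y. ennreal \<bar>g y\<bar>) \<le> ennreal (\<kappa> powr (r - 1))"
  proof (cases rule: conjugate_exponents_cases[OF pq])
    case pq': (1 a b)
    then have b: "b = r" and ra: "(r - 1) * a = r" using 1 by (auto simp: field_simps)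
    have "epow (ennreal \<bar>g y\<bar>) a = ennreal (\<bar>K y\<bar> powr r)" for y
      by (cases "K y = 0") (auto simp: g_def abs_mult abs_sgn_eq powr_powr ra)
    then have "lqnorm M p (\<lambda>y. ennreal \<bar>g y\<bar>) = epow (ennreal (\<kappa> powr r)) (1 / a)"
      using pq' I by (simp add: lqnorm_real)
    also have "\<dots> = ennreal (\<kappa> powr (r - 1))"
    proof -
      have "r * (1 / a) = r - 1" using ra pq' by (simp add: field_simps)
      then show ?thesis by (simp add: powr_powr)
    qed
    finally show ?thesis by simp
  next
    case pq': 3
    then have "r = 1" using 1 by (auto simp: one_ereal_def)
    then have "AE y in M. ennreal \<bar>g y\<bar> \<le> ennreal (\<kappa> powr (r - 1))"
      using k0 by (auto simp: g_def abs_mult abs_sgn_eq)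
    then show ?thesis unfolding pq' lqnorm_infty by (intro esssup_I) auto
  qed (use 1 in auto)
  have "t * lqnorm M p (\<lambda>y. ennreal \<bar>g y\<bar>) \<le> ennreal \<kappa> * ennreal (\<kappa> powr (r - 1))"
    using t ng unfolding k by (intro mult_mono) auto
  also have "\<dots> = ennreal (\<integral>y. K y * g y \<partial>M)"
    unfolding int using k0 by (simp add: ennreal_mult[symmetric] powr_diff)
  finally have main: "t * lqnorm M p (\<lambda>y. ennreal \<bar>g y\<bar>) \<le> ennreal (\<integral>y. K y * g y \<partial>M)" .
  \<comment> \<open>Hoelder's inequality rules out a vanishing norm of \<open>g\<close>: the
    integral of |g| |K| is positive.\<close>
  have "0 < ennreal (\<kappa> powr r)" using k0 by simp
  also have "ennreal (\<kappa> powr r) = (\<integral>\<^sup>+ y. ennreal \<bar>g y\<bar> * ennreal \<bar>K y\<bar> \<partial>M)"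
    unfolding I[symmetric] Kg[symmetric]
    by (intro nn_integral_cong) (auto simp: ennreal_mult[symmetric] g_def sgn_if abs_mult mult.commute)
  also have "\<dots> \<le> lqnorm M p (\<lambda>y. ennreal \<bar>g y\<bar>) * lqnorm M q (\<lambda>y. ennreal \<bar>K y\<bar>)"
    using pq by (intro Hoelder) auto
  finally have "lqnorm M p (\<lambda>y. ennreal \<bar>g y\<bar>) \<noteq> 0" by auto
  moreover have "in_Lp M p g"
    unfolding in_Lp_def using ng by (auto intro: le_less_trans)
  ultimately show ?thesis using main that by blast
next
  case 2
  then have p: "p = 1" by (cases rule: conjugate_exponents_cases[OF pq]) auto
  have "t < \<infinity>" using t by (metis infinity_ennreal_def not_top_less top.not_eq_extremum)
  then obtain \<tau> where \<tau>: "t = ennreal \<tau>" "0 \<le> \<tau>" by (cases t) auto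
  define \<kappa> where "\<kappa> = enn2real (lqnorm M q (\<lambda>y. ennreal \<bar>K y\<bar>))"
  have k: "lqnorm M q (\<lambda>y. ennreal \<bar>K y\<bar>) = ennreal \<kappa>"
    using fin by (simp add: \<kappa>_def)
  have Kk: "AE y in M. \<bar>K y\<bar> \<le> \<kappa>"
    using esssup_AE[where M=M and f="\<lambda>y. ennreal \<bar>K y\<bar>"] k unfolding 2 lqnorm_infty
    by (auto elim!: eventually_mono simp: \<kappa>_def)
  define A where "A = {y\<in>space M. \<tau> < \<bar>K y\<bar>}"
  have [measurable]: "A \<in> sets M" unfolding A_def by measurable
  have A0: "emeasure M A \<noteq> 0"
  proof
    assume "emeasure M A = 0"
    then have "AE y in M. ennreal \<bar>K y\<bar> \<le> t"
      using \<tau> by (intro AE_I[of _ _ A]) (auto simp: A_def not_le)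
    then have "lqnorm M q (\<lambda>y. ennreal \<bar>K y\<bar>) \<le> t"
      unfolding 2 lqnorm_infty by (intro esssup_I) auto
    then show False using t by simp
  qed
  define g where "g y = sgn (K y) * indicator A y" for y
  have [measurable]: "g \<in> borel_measurable M" unfolding g_def by measurable
  have "lqnorm M p (\<lambda>y. ennreal \<bar>g y\<bar>) = (\<integral>\<^sup>+ y. indicator A y \<partial>M)"
    unfolding p lqnorm_1 using \<tau>(2)
    by (intro nn_integral_cong) (auto simp: g_def A_def abs_mult abs_sgn_eq split: split_indicator)
  then have ng: "lqnorm M p (\<lambda>y. ennreal \<bar>g y\<bar>) = emeasure M A" by simp
  have Kg: "K y * g y = \<bar>K y\<bar> * indicator A y" for y
    by (auto simp: g_def sgn_if split: split_indicator)
  have "integrable M (\<lambda>y. K y * g y)"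
    unfolding Kg using Kk
    by (intro integrable_const_bound[where B=\<kappa>]) (auto elim!: eventually_mono split: split_indicator simp: \<kappa>_def)
  then have "ennreal (\<integral>y. K y * g y \<partial>M) = (\<integral>\<^sup>+ y. ennreal (K y * g y) \<partial>M)"
    by (subst nn_integral_eq_integral) (auto simp: Kg)
  also have "\<dots> \<ge> (\<integral>\<^sup>+ y. t * indicator A y \<partial>M)"
    unfolding Kg using \<tau>
    by (intro nn_integral_mono) (auto simp: A_def intro!: ennreal_leI split: split_indicator)
  finally have "t * emeasure M A \<le> ennreal (\<integral>y. K y * g y \<partial>M)"
    by (simp add: nn_integral_cmult)
  moreover have "emeasure M A < \<infinity>" by (simp add: less_top[symmetric])
  ultimately show ?thesis
    using that[of g] A0 ng by (simp add: in_Lp_def)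
qed

section \<open>The upper Marcinkiewicz--Zygmund inequality\<close>

text \<open>A bound on 2 cosh x. For |x| \<le> 1 the linear terms of the quadratic bounds at x and
  -x cancel; for larger |x| both exponents are at most x^2.\<close>

lemma exp_add_exp_minus_le: "exp x + exp (- x) \<le> 2 * exp (x\<^sup>2 :: real)"
proof (cases "\<bar>x\<bar> \<le> 1")
  case True
  have bound: "exp t \<le> 1 + t + t\<^sup>2" if "\<bar>t\<bar> \<le> 1" for t :: real
  proof (cases "0 \<le> t")
    case False
    \<comment> \<open>The product equals 1 - t^3, and t is negative.\<close>
    have "(1 + t + t\<^sup>2) * (1 - t) \<ge> 1"
      using False mult_nonneg_nonpos[of "t * t" t] by (simp add: power2_eq_square algebra_simps)
    then have "1 / (1 - t) \<le> 1 + t + t\<^sup>2"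
      using False by (simp add: divide_le_eq)
    moreover have "exp t \<le> 1 / (1 - t)"
      using exp_ge_add_one_self[of "- t"] False by (simp add: exp_minus field_simps)
    ultimately show ?thesis by simp
  qed (use that in \<open>simp add: exp_bound\<close>)
  have "exp x + exp (- x) \<le> 2 * (1 + x\<^sup>2)"
    using bound[of x] bound[of "- x"] True by simp
  also have "\<dots> \<le> 2 * exp (x\<^sup>2)"
    using exp_ge_add_one_self[of "x\<^sup>2"] by (intro mult_left_mono) auto
  finally show ?thesis .
next
  case False
  then have "\<bar>x\<bar> * 1 \<le> \<bar>x\<bar> * \<bar>x\<bar>" by (intro mult_left_mono) auto
  then have "\<bar>x\<bar> \<le> x\<^sup>2" by (simp add: power2_eq_square)
  then have "exp x + exp (- x) \<le> exp (x\<^sup>2) + exp (x\<^sup>2)" by (intro add_mono) auto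
  then show ?thesis by simp
qed

text \<open>The q-th power of u \<le> exp u at u = |x| / q; this is the origin of the factor
  q^q.\<close>

lemma abs_powr_le_exp:
  assumes "1 \<le> (q::real)"
  shows "\<bar>x\<bar> powr q \<le> q powr q * (exp x + exp (- x))"
proof -
  have "\<bar>x\<bar> / q \<le> exp (\<bar>x\<bar> / q)"
    using exp_ge_add_one_self[of "\<bar>x\<bar> / q"] by linarith
  then have "\<bar>x\<bar> \<le> q * exp (\<bar>x\<bar> / q)"
    using assms by (simp add: field_simps)
  then have "\<bar>x\<bar> powr q \<le> (q * exp (\<bar>x\<bar> / q)) powr q"
    using assms by (intro powr_mono2) auto
  also have "\<dots> = q powr q * exp \<bar>x\<bar>"
    using assms by (simp add: powr_mult) (simp add: powr_def)
  also have "\<dots> \<le> q powr q * (exp x + exp (- x))"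
    by (intro mult_left_mono) (auto simp: abs_if)
  finally show ?thesis .
qed

text \<open>A subset \<open>B\<close> encodes a choice of signs, plus on \<open>B\<close> and minus
  on \<open>A - B\<close>. The sum over all choices factorises over the indices, as an expectation
  over independent signs would.\<close>

lemma signed_exp_sum_le:
  fixes a :: "'i \<Rightarrow> real"
  assumes "finite A"
  shows "(\<Sum>B\<in>Pow A. exp (sum a B - sum a (A - B))) \<le> 2 ^ card A * exp (\<Sum>i\<in>A. (a i)\<^sup>2)"
proof -
  have "(\<Sum>B\<in>Pow A. exp (sum a B - sum a (A - B)))
      = (\<Sum>B\<in>Pow A. (\<Prod>i\<in>B. exp (a i)) * (\<Prod>i\<in>A - B. exp (- a i)))"
    using assms
    by (intro sum.cong refl)
      (auto simp: exp_sum[symmetric] exp_add[symmetric] sum_negf finite_subset[of _ A])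
  also have "\<dots> = (\<Prod>i\<in>A. exp (a i) + exp (- a i))"
    by (rule prod_add[OF assms, symmetric])
  also have "\<dots> \<le> (\<Prod>i\<in>A. 2 * exp ((a i)\<^sup>2))"
    by (intro prod_mono) (auto intro: exp_add_exp_minus_le add_nonneg_nonneg)
  also have "\<dots> = 2 ^ card A * exp (\<Sum>i\<in>A. (a i)\<^sup>2)"
    using assms by (simp add: prod.distrib exp_sum)
  finally show ?thesis .
qed

text \<open>By homogeneity the Euclidean norm of the coefficients may be taken to be 1. Powers are
  then dominated by exponentials: \<open>abs_powr_le_exp\<close> gives q^q, and each of the two
  exponentials contributes exp 1 to the average over signs.\<close>

lemma Khinchine_upper:
  fixes a :: "'i \<Rightarrow> real"
  assumes A: "finite A" and q: "1 \<le> q"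
  shows "(\<Sum>B\<in>Pow A. \<bar>sum a B - sum a (A - B)\<bar> powr q)
      \<le> 2 ^ card A * (2 * exp 1 * q powr q) * (\<Sum>i\<in>A. (a i)\<^sup>2) powr (q / 2)"
proof (cases "(\<Sum>i\<in>A. (a i)\<^sup>2) = 0")
  case True
  then have "a i = 0" if "i \<in> A" for i
    using A that by (simp add: sum_nonneg_eq_0_iff)
  then have "sum a B = 0" if "B \<subseteq> A" for B
    using that by (intro sum.neutral) auto
  then have "(\<Sum>B\<in>Pow A. \<bar>sum a B - sum a (A - B)\<bar> powr q) = 0"
    by (intro sum.neutral) auto
  then show ?thesis by simp
next
  case False
  define s where "s = sqrt (\<Sum>i\<in>A. (a i)\<^sup>2)"
  have s0: "s > 0" using False by (simp add: s_def sum_nonneg less_le)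
  have s2: "(\<Sum>i\<in>A. (a i)\<^sup>2) = s\<^sup>2" by (simp add: s_def sum_nonneg)
  have sq: "(\<Sum>i\<in>A. (a i)\<^sup>2) powr (q / 2) = s powr q"
    unfolding s2 using s0 by (simp add: powr_powr powr_realpow[symmetric] del: powr_numeral)
  define b where "b i = a i / s" for i
  have b1: "(\<Sum>i\<in>A. (b i)\<^sup>2) = 1"
    using s0 unfolding b_def power_divide sum_divide_distrib[symmetric] s2 by simp
  have ab: "sum a B = s * sum b B" for B
    using s0 by (simp add: b_def sum_divide_distrib[symmetric])
  have "(\<Sum>B\<in>Pow A. \<bar>sum b B - sum b (A - B)\<bar> powr q)
      \<le> (\<Sum>B\<in>Pow A. q powr q * (exp (sum b B - sum b (A - B)) + exp (- (sum b B - sum b (A - B)))))"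
    by (intro sum_mono abs_powr_le_exp q)
  also have "\<dots> = q powr q * ((\<Sum>B\<in>Pow A. exp (sum b B - sum b (A - B)))
      + (\<Sum>B\<in>Pow A. exp (sum (\<lambda>i. - b i) B - sum (\<lambda>i. - b i) (A - B))))"
    by (simp add: sum_distrib_left[symmetric] sum.distrib sum_negf algebra_simps)
  also have "\<dots> \<le> q powr q * (2 ^ card A * exp 1 + 2 ^ card A * exp 1)"
    using signed_exp_sum_le[OF A, of b] signed_exp_sum_le[OF A, of "\<lambda>i. - b i"] b1
    by (intro mult_left_mono add_mono) auto
  finally have *: "(\<Sum>B\<in>Pow A. \<bar>sum b B - sum b (A - B)\<bar> powr q) \<le> 2 ^ card A * (2 * exp 1 * q powr q)"
    by (simp add: algebra_simps)
  have "(\<Sum>B\<in>Pow A. \<bar>sum a B - sum a (A - B)\<bar> powr q)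
      = s powr q * (\<Sum>B\<in>Pow A. \<bar>sum b B - sum b (A - B)\<bar> powr q)"
    unfolding ab right_diff_distrib[symmetric] abs_mult
    using s0 by (subst powr_mult) (auto simp: sum_distrib_left[symmetric])
  also have "\<dots> \<le> s powr q * (2 ^ card A * (2 * exp 1 * q powr q))"
    using * by (intro mult_left_mono) auto
  finally show ?thesis unfolding sq by (simp add: mult_ac)
qed

lemma powr_add_le:
  assumes "0 \<le> q" "0 \<le> (a::real)" "0 \<le> b"
  shows "(a + b) powr q \<le> 2 powr q * (a powr q + b powr q)"
proof -
  have "(a + b) powr q \<le> (2 * max a b) powr q"
    using assms by (intro powr_mono2) auto
  also have "\<dots> = 2 powr q * max a b powr q"
    using assms by (simp add: powr_mult)
  also have "\<dots> \<le> 2 powr q * (a powr q + b powr q)"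
    by (intro mult_left_mono) (auto simp: max_def)
  finally show ?thesis .
qed

lemma abs_le_1_plus_powr: "1 \<le> q \<Longrightarrow> \<bar>x::real\<bar> \<le> 1 + \<bar>x\<bar> powr q"
proof (cases "\<bar>x\<bar> \<le> 1")
  case False
  assume "1 \<le> q"
  then have "\<bar>x\<bar> powr 1 \<le> \<bar>x\<bar> powr q" using False by (intro powr_mono) auto
  then show ?thesis using False by simp
qed (simp add: add_increasing2)

text \<open>The tangent of |.|^q at \<open>u\<close> lies below the function. It follows from
  \<open>powr_tangent\<close> and |u| + sgn u * v \<le> |u + v|.\<close>

lemma abs_add_powr_ge:
  fixes u v :: real
  assumes "1 \<le> q"
  shows "\<bar>u\<bar> powr q + q * (sgn u * \<bar>u\<bar> powr (q - 1)) * v \<le> \<bar>u + v\<bar> powr q"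
proof -
  have 1: "q * (\<bar>u\<bar> + sgn u * v) * \<bar>u\<bar> powr (q - 1) \<le> q * \<bar>u + v\<bar> * \<bar>u\<bar> powr (q - 1)"
    using assms by (intro mult_right_mono mult_left_mono) (auto simp: sgn_if)
  have 2: "q * \<bar>u + v\<bar> * \<bar>u\<bar> powr (q - 1) \<le> \<bar>u + v\<bar> powr q + (q - 1) * \<bar>u\<bar> powr q"
    using assms by (intro powr_tangent) auto
  have "\<bar>u\<bar> * \<bar>u\<bar> powr (q - 1) = \<bar>u\<bar> powr q"
    by (cases "u = 0") (auto simp: powr_diff)
  then have 3: "q * (\<bar>u\<bar> + sgn u * v) * \<bar>u\<bar> powr (q - 1)
      = q * \<bar>u\<bar> powr q + q * (sgn u * \<bar>u\<bar> powr (q - 1)) * v"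
    by (simp add: algebra_simps)
  have "q * \<bar>u\<bar> powr q + q * (sgn u * \<bar>u\<bar> powr (q - 1)) * v \<le> \<bar>u + v\<bar> powr q + (q - 1) * \<bar>u\<bar> powr q"
    using 1 2 unfolding 3 by simp
  then show ?thesis by (simp add: left_diff_distrib)
qed

section \<open>Symmetrisation and the upper Marcinkiewicz--Zygmund inequality\<close>

context prob_space
begin

lemma integrable_abs_powr_sum:
  fixes X :: "'i \<Rightarrow> 'a \<Rightarrow> real"
  assumes "finite A" and q: "1 \<le> q"
    and [measurable]: "\<And>i. i \<in> A \<Longrightarrow> X i \<in> borel_measurable M"
    and "\<And>i. i \<in> A \<Longrightarrow> integrable M (\<lambda>x. \<bar>X i x\<bar> powr q)"
  shows "integrable M (\<lambda>x. (\<Sum>i\<in>A. \<bar>X i x\<bar>) powr q)"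
  using assms(1,3,4)
proof (induction rule: finite_induct)
  case (insert i A)
  have "integrable M (\<lambda>x. 2 powr q * (\<bar>X i x\<bar> powr q + (\<Sum>i\<in>A. \<bar>X i x\<bar>) powr q))"
    using insert by auto
  then show ?case
  proof (rule Bochner_Integration.integrable_bound)
    show "(\<lambda>x. (\<Sum>i\<in>insert i A. \<bar>X i x\<bar>) powr q) \<in> borel_measurable M"
      using insert.prems(1) by measurable
    show "AE x in M. norm ((\<Sum>i\<in>insert i A. \<bar>X i x\<bar>) powr q)
        \<le> norm (2 powr q * (\<bar>X i x\<bar> powr q + (\<Sum>i\<in>A. \<bar>X i x\<bar>) powr q))"
      using insert.hyps q
      by (intro AE_I2) (auto intro!: powr_add_le sum_nonneg simp: abs_mult)
  qed
qed simp

text \<open>Partial sums, signed sums and the square function are all dominated by the sum of the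
  absolute values, so this settles their q-th moments uniformly.\<close>

lemma integrable_dominated_sum:
  fixes X :: "'i \<Rightarrow> 'a \<Rightarrow> real"
  assumes "finite A" "1 \<le> q"
    and "\<And>i. i \<in> A \<Longrightarrow> X i \<in> borel_measurable M"
    and "\<And>i. i \<in> A \<Longrightarrow> integrable M (\<lambda>x. \<bar>X i x\<bar> powr q)"
    and Y: "Y \<in> borel_measurable M" "\<And>x. 0 \<le> Y x" "\<And>x. Y x \<le> (\<Sum>i\<in>A. \<bar>X i x\<bar>)"
  shows "integrable M (\<lambda>x. Y x powr q)"
  using integrable_abs_powr_sum[OF assms(1-4)]
proof (rule Bochner_Integration.integrable_bound)
  show "(\<lambda>x. Y x powr q) \<in> borel_measurable M" using Y(1) by measurable
  show "AE x in M. norm (Y x powr q) \<le> norm ((\<Sum>i\<in>A. \<bar>X i x\<bar>) powr q)"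
    using assms(2) Y by (intro AE_I2) (auto intro!: powr_mono2)
qed

lemma integrable_of_abs_powr:
  fixes U :: "'a \<Rightarrow> real"
  assumes "1 \<le> q" "U \<in> borel_measurable M" "integrable M (\<lambda>x. \<bar>U x\<bar> powr q)"
  shows "integrable M U"
proof (rule Bochner_Integration.integrable_bound)
  show "integrable M (\<lambda>x. 1 + \<bar>U x\<bar> powr q)" using assms by auto
  show "AE x in M. norm (U x) \<le> norm (1 + \<bar>U x\<bar> powr q)"
    using abs_le_1_plus_powr[OF assms(1)] by (intro AE_I2) (auto intro: order_trans[OF _ abs_ge_self])
qed (use assms in auto)

text \<open>Conditional Jensen in tangent form: the linear term of \<open>abs_add_powr_ge\<close> is
  a multiple of h(U) * V, whose expectation factorises by independence and vanishes with that of
  \<open>V\<close>.\<close>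

lemma expectation_abs_powr_le_add_centered:
  fixes U V :: "'a \<Rightarrow> real"
  assumes q: "1 \<le> q" and ind: "indep_var borel U borel V"
    and U: "integrable M (\<lambda>x. \<bar>U x\<bar> powr q)"
    and V: "integrable M V" "expectation V = 0"
    and UV: "integrable M (\<lambda>x. \<bar>U x + V x\<bar> powr q)"
  shows "expectation (\<lambda>x. \<bar>U x\<bar> powr q) \<le> expectation (\<lambda>x. \<bar>U x + V x\<bar> powr q)"
proof -
  have [measurable]: "U \<in> borel_measurable M"
    using ind by (simp add: indep_var_rv1)
  define h where "h u = sgn u * \<bar>u\<bar> powr (q - 1)" for u :: real
  have [measurable]: "h \<in> borel_measurable borel" unfolding h_def by measurable
  have hU: "integrable M (\<lambda>x. h (U x))"
  proof (rule Bochner_Integration.integrable_bound)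
    show "integrable M (\<lambda>x. 1 + \<bar>U x\<bar> powr q)" using U by auto
    have "\<bar>h u\<bar> \<le> 1 + \<bar>u\<bar> powr q" for u
    proof (cases "\<bar>u\<bar> \<le> 1")
      case True
      then have "\<bar>u\<bar> powr (q - 1) \<le> 1" using q by (intro powr_le1) auto
      then show ?thesis by (auto simp: h_def abs_mult abs_sgn_eq intro: add_increasing2)
    next
      case False
      then have "\<bar>u\<bar> powr (q - 1) \<le> \<bar>u\<bar> powr q" using q by (intro powr_mono) auto
      then show ?thesis by (auto simp: h_def abs_mult abs_sgn_eq)
    qed
    then show "AE x in M. norm (h (U x)) \<le> norm (1 + \<bar>U x\<bar> powr q)"
      by (intro AE_I2) (auto intro: order_trans[OF _ abs_ge_self])
  qed measurable
  have "indep_var borel (h \<circ> U) borel ((\<lambda>x. x) \<circ> V)"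
    by (intro indep_var_compose[OF ind]) auto
  then have ind': "indep_var borel (\<lambda>x. h (U x)) borel V" by (simp add: comp_def)
  have int: "integrable M (\<lambda>x. h (U x) * V x)"
    using indep_var_integrable[OF ind' hU V(1)] .
  have "expectation (\<lambda>x. h (U x) * V x) = 0"
    using indep_var_lebesgue_integral[OF ind' hU V(1)] V(2) by simp
  then have "expectation (\<lambda>x. \<bar>U x\<bar> powr q) = expectation (\<lambda>x. \<bar>U x\<bar> powr q + q * (h (U x) * V x))"
    using U int by simp
  also have "\<dots> \<le> expectation (\<lambda>x. \<bar>U x + V x\<bar> powr q)"
  proof (rule integral_mono)
    fix x show "\<bar>U x\<bar> powr q + q * (h (U x) * V x) \<le> \<bar>U x + V x\<bar> powr q"
      using abs_add_powr_ge[OF q, of "U x" "V x"] by (simp add: h_def mult.assoc)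
  qed (use U int UV in auto)
  finally show ?thesis .
qed

lemma indep_vars_sum_sum:
  fixes X :: "'i \<Rightarrow> 'a \<Rightarrow> real"
  assumes ind: "indep_vars (\<lambda>_. borel) X I" and AB: "A \<inter> B = {}" "A \<subseteq> I" "B \<subseteq> I"
  shows "indep_var borel (\<lambda>x. \<Sum>i\<in>A. X i x) borel (\<lambda>x. \<Sum>i\<in>B. X i x)"
proof -
  have "indep_var
    borel ((\<lambda>f. \<Sum>i\<in>A. f i) \<circ> (\<lambda>\<omega>. restrict (\<lambda>i. X i \<omega>) A))
    borel ((\<lambda>f. \<Sum>i\<in>B. f i) \<circ> (\<lambda>\<omega>. restrict (\<lambda>i. X i \<omega>) B))"
    by (intro indep_var_compose[OF indep_var_restrict[OF ind AB]]) auto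
  then show ?thesis by (simp add: comp_def)
qed

text \<open>Symmetrisation inside the given space. For each sign pattern \<open>B\<close> the full
  sum splits into the parts over \<open>B\<close> and \<open>A - B\<close>, and each part is
  controlled by their difference, which only adds an independent centred term. The average over all
  patterns is then bounded by Khinchine's inequality at every point. The factor 2^(q + 1) comes from
  splitting a power of a sum and from having two parts.\<close>

lemma Marcinkiewicz_Zygmund_upper:
  fixes X :: "'i \<Rightarrow> 'a \<Rightarrow> real"
  assumes A: "finite A" and q: "1 \<le> q" and ind: "indep_vars (\<lambda>_. borel) X A"
    and X: "\<And>i. i \<in> A \<Longrightarrow> integrable M (\<lambda>x. \<bar>X i x\<bar> powr q)"
    and X0: "\<And>i. i \<in> A \<Longrightarrow> expectation (X i) = 0"
  shows "expectation (\<lambda>x. \<bar>\<Sum>i\<in>A. X i x\<bar> powr q)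
      \<le> 2 powr (q + 1) * (2 * exp 1 * q powr q) * expectation (\<lambda>x. (\<Sum>i\<in>A. (X i x)\<^sup>2) powr (q / 2))"
proof -
  have meas [measurable]: "\<And>i. i \<in> A \<Longrightarrow> X i \<in> borel_measurable M"
    using ind by (auto simp: indep_vars_def)
  have intX: "integrable M (X i)" if "i \<in> A" for i
    using q meas[OF that] X[OF that] by (rule integrable_of_abs_powr)
  define S where "S B x = (\<Sum>i\<in>B. X i x)" for B x
  have S_le: "\<bar>S B x\<bar> \<le> (\<Sum>i\<in>A. \<bar>X i x\<bar>)" if "B \<subseteq> A" for B x
    unfolding S_def using that A by (intro order_trans[OF sum_abs] sum_mono2) auto
  have D_le: "\<bar>S B x - S (A - B) x\<bar> \<le> (\<Sum>i\<in>A. \<bar>X i x\<bar>)" if "B \<subseteq> A" for B x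
  proof -
    have "\<bar>S B x - S (A - B) x\<bar> \<le> (\<Sum>i\<in>B. \<bar>X i x\<bar>) + (\<Sum>i\<in>A - B. \<bar>X i x\<bar>)"
      unfolding S_def by (intro order_trans[OF abs_triangle_ineq4] add_mono sum_abs)
    also have "\<dots> = (\<Sum>i\<in>A. \<bar>X i x\<bar>)"
      using that A by (metis add.commute sum.subset_diff)
    finally show ?thesis .
  qed
  have measS [measurable]: "S B \<in> borel_measurable M" if "B \<subseteq> A" for B
    unfolding S_def using that by (intro borel_measurable_sum) auto
  have intS: "integrable M (\<lambda>x. \<bar>S B x\<bar> powr q)" if "B \<subseteq> A" for B
    by (rule integrable_dominated_sum[OF A q meas X]) (use that S_le in auto)
  have intD: "integrable M (\<lambda>x. \<bar>S B x - S (A - B) x\<bar> powr q)" if "B \<subseteq> A" for B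
    by (rule integrable_dominated_sum[OF A q meas X]) (use that D_le in auto)
  have S0: "integrable M (S B)" "expectation (S B) = 0" if "B \<subseteq> A" for B
    unfolding S_def using that intX X0 by (auto simp: subset_eq Bochner_Integration.integral_sum)
  have half: "expectation (\<lambda>x. \<bar>S B x\<bar> powr q) \<le> expectation (\<lambda>x. \<bar>S B x - S (A - B) x\<bar> powr q)"
    if B: "B \<subseteq> A" for B
  proof -
    have "indep_var borel (S B) borel (S (A - B))"
      unfolding S_def using B by (intro indep_vars_sum_sum[OF ind]) auto
    then have "indep_var borel ((\<lambda>x. x) \<circ> S B) borel (uminus \<circ> S (A - B))"
      by (rule indep_var_compose) auto
    then have "indep_var borel (S B) borel (\<lambda>x. - S (A - B) x)"
      by (simp add: comp_def)
    from expectation_abs_powr_le_add_centered[OF q this] show ?thesis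
      using B S0[of "A - B"] intS intD by simp
  qed
  have one: "expectation (\<lambda>x. \<bar>S A x\<bar> powr q)
      \<le> 2 powr (q + 1) * expectation (\<lambda>x. \<bar>S B x - S (A - B) x\<bar> powr q)" if B: "B \<subseteq> A" for B
  proof -
    have "S A x = S B x + S (A - B) x" for x
      unfolding S_def using A B by (metis add.commute sum.subset_diff)
    then have "\<bar>S A x\<bar> powr q \<le> 2 powr q * (\<bar>S B x\<bar> powr q + \<bar>S (A - B) x\<bar> powr q)" for x
      using q by (intro order_trans[OF powr_mono2 powr_add_le]) auto
    then have "expectation (\<lambda>x. \<bar>S A x\<bar> powr q)
        \<le> expectation (\<lambda>x. 2 powr q * (\<bar>S B x\<bar> powr q + \<bar>S (A - B) x\<bar> powr q))"
      using B intS by (intro integral_mono) auto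
    also have "\<dots> = 2 powr q * (expectation (\<lambda>x. \<bar>S B x\<bar> powr q) + expectation (\<lambda>x. \<bar>S (A - B) x\<bar> powr q))"
      using B intS by simp
    also have "\<dots> \<le> 2 powr q * (expectation (\<lambda>x. \<bar>S B x - S (A - B) x\<bar> powr q)
        + expectation (\<lambda>x. \<bar>S B x - S (A - B) x\<bar> powr q))"
    proof (intro mult_left_mono add_mono half B)
      \<comment> \<open>Exchanging the two parts only flips the sign of the difference.\<close>
      have "A - (A - B) = B" using B by auto
      then show "expectation (\<lambda>x. \<bar>S (A - B) x\<bar> powr q) \<le> expectation (\<lambda>x. \<bar>S B x - S (A - B) x\<bar> powr q)"
        using half[of "A - B"] by (simp add: abs_minus_commute)
    qed simp
    finally show ?thesis by (simp add: powr_add)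
  qed
  have intQ: "integrable M (\<lambda>x. (\<Sum>i\<in>A. (X i x)\<^sup>2) powr (q / 2))"
  proof -
    have "integrable M (\<lambda>x. sqrt (\<Sum>i\<in>A. (X i x)\<^sup>2) powr q)"
      by (rule integrable_dominated_sum[OF A q meas X])
        (use L2_set_le_sum_abs[of "\<lambda>i. X i _" A] in \<open>auto simp: L2_set_def sum_nonneg\<close>)
    then show ?thesis
      by (simp add: powr_half_sqrt[symmetric] powr_powr sum_nonneg)
  qed
  have cP: "real (card (Pow A)) = 2 ^ card A" using A by (simp add: card_Pow)
  \<comment> \<open>The left side does not depend on \<open>B\<close>, so the estimate
    \<open>one\<close> may be summed over all sign patterns.\<close>
  have "2 ^ card A * expectation (\<lambda>x. \<bar>S A x\<bar> powr q)
      = (\<Sum>B\<in>Pow A. expectation (\<lambda>x. \<bar>S A x\<bar> powr q))"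
    by (simp add: cP)
  also have "\<dots> \<le> (\<Sum>B\<in>Pow A. 2 powr (q + 1) * expectation (\<lambda>x. \<bar>S B x - S (A - B) x\<bar> powr q))"
    by (intro sum_mono one) auto
  also have "\<dots> = 2 powr (q + 1) * expectation (\<lambda>x. \<Sum>B\<in>Pow A. \<bar>S B x - S (A - B) x\<bar> powr q)"
    using intD by (simp add: sum_distrib_left Bochner_Integration.integral_sum)
  also have "\<dots> \<le> 2 powr (q + 1) * expectation (\<lambda>x. 2 ^ card A * (2 * exp 1 * q powr q)
      * (\<Sum>i\<in>A. (X i x)\<^sup>2) powr (q / 2))"
    using intD intQ unfolding S_def
    by (intro mult_left_mono integral_mono Khinchine_upper A q) auto
  also have "\<dots> = 2 ^ card A * (2 powr (q + 1) * (2 * exp 1 * q powr q)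
      * expectation (\<lambda>x. (\<Sum>i\<in>A. (X i x)\<^sup>2) powr (q / 2)))"
    by simp
  finally show ?thesis by (simp add: S_def)
qed

text \<open>By Fubini almost every translate \<open>U + v\<close> has a finite moment, hence so has \<open>U\<close> itself.\<close>
lemma finite_moment_of_indep_sum:
  fixes U V :: "'a \<Rightarrow> real"
  assumes q: "1 \<le> q" and ind: "indep_var borel U borel V"
    and fin: "(\<integral>\<^sup>+ x. ennreal (\<bar>U x + V x\<bar> powr q) \<partial>M) < \<infinity>"
  shows "(\<integral>\<^sup>+ x. ennreal (\<bar>U x\<bar> powr q) \<partial>M) < \<infinity>"
proof -
  have [measurable]: "U \<in> borel_measurable M" "V \<in> borel_measurable M"
    using ind by (auto simp: indep_var_rv1 indep_var_rv2)
  interpret MU: prob_space "distr M borel U" by (rule prob_space_distr) simp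
  interpret MV: prob_space "distr M borel V" by (rule prob_space_distr) simp
  interpret pair_sigma_finite "distr M borel U" "distr M borel V" ..
  have jd: "distr M borel U \<Otimes>\<^sub>M distr M borel V = distr M (borel \<Otimes>\<^sub>M borel) (\<lambda>x. (U x, V x))"
    using ind by (simp add: indep_var_distribution_eq)
  have "(\<integral>\<^sup>+ v. \<integral>\<^sup>+ u. ennreal (\<bar>u + v\<bar> powr q) \<partial>distr M borel U \<partial>distr M borel V)
      = (\<integral>\<^sup>+ z. ennreal (\<bar>fst z + snd z\<bar> powr q) \<partial>(distr M borel U \<Otimes>\<^sub>M distr M borel V))"
    by (subst nn_integral_snd[symmetric]) auto
  also have "\<dots> = (\<integral>\<^sup>+ x. ennreal (\<bar>U x + V x\<bar> powr q) \<partial>M)"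
    unfolding jd by (subst nn_integral_distr) auto
  finally have "(\<integral>\<^sup>+ v. \<integral>\<^sup>+ u. ennreal (\<bar>u + v\<bar> powr q) \<partial>distr M borel U \<partial>distr M borel V) \<noteq> \<infinity>"
    using fin by simp
  then have "AE v in distr M borel V. (\<integral>\<^sup>+ u. ennreal (\<bar>u + v\<bar> powr q) \<partial>distr M borel U) \<noteq> \<infinity>"
    by (intro nn_integral_PInf_AE) auto
  then obtain v where v: "(\<integral>\<^sup>+ u. ennreal (\<bar>u + v\<bar> powr q) \<partial>distr M borel U) \<noteq> \<infinity>"
    using MV.AE_contr[of "\<lambda>v. (\<integral>\<^sup>+ u. ennreal (\<bar>u + v\<bar> powr q) \<partial>distr M borel U) \<noteq> \<infinity>"] by force
  have "(\<integral>\<^sup>+ u. ennreal (\<bar>u\<bar> powr q) \<partial>distr M borel U)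
      \<le> (\<integral>\<^sup>+ u. ennreal (2 powr q) * (ennreal (\<bar>u + v\<bar> powr q) + ennreal (\<bar>v\<bar> powr q)) \<partial>distr M borel U)"
  proof (intro nn_integral_mono)
    fix u
    have "\<bar>u\<bar> powr q \<le> 2 powr q * (\<bar>u + v\<bar> powr q + \<bar>v\<bar> powr q)"
      using q by (intro order_trans[OF powr_mono2 powr_add_le]) auto
    then show "ennreal (\<bar>u\<bar> powr q) \<le> ennreal (2 powr q) * (ennreal (\<bar>u + v\<bar> powr q) + ennreal (\<bar>v\<bar> powr q))"
      by (simp add: ennreal_mult[symmetric] ennreal_plus[symmetric] ennreal_leI del: ennreal_plus)
  qed
  also have "\<dots> = ennreal (2 powr q) * ((\<integral>\<^sup>+ u. ennreal (\<bar>u + v\<bar> powr q) \<partial>distr M borel U) + ennreal (\<bar>v\<bar> powr q))"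
    by (simp add: nn_integral_cmult nn_integral_add MU.emeasure_space_1[simplified])
  also have "\<dots> < \<infinity>"
    using v by (auto simp: ennreal_mult_less_top less_top)
  finally show ?thesis by (simp add: nn_integral_distr)
qed

end

section \<open>The best constants\<close>

context prob_space
begin

text \<open>\<open>Q\<close> is the joint law of the family. Independence means that the joint law
  is the product of the marginals, so it passes to the coordinates.\<close>

lemma indep_vars_coordinates:
  fixes X :: "nat \<Rightarrow> 'a \<Rightarrow> real"
  assumes ind: "indep_vars (\<lambda>_. borel) X {..<n}"
  defines "Q \<equiv> distr M (\<Pi>\<^sub>M i\<in>{..<n}. borel) (\<lambda>x. \<lambda>i\<in>{..<n}. X i x)"
  shows "prob_space Q" "prob_space.indep_vars Q (\<lambda>_. borel) (\<lambda>i \<xi>. \<xi> i) {..<n}"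
proof -
  have [measurable]: "\<And>i. i < n \<Longrightarrow> X i \<in> borel_measurable M"
    using ind by (auto simp: indep_vars_def)
  show "prob_space Q"
    unfolding Q_def by (intro prob_space_distr) measurable
  then interpret Q: prob_space Q .
  have setsQ [measurable_cong]: "sets Q = sets (\<Pi>\<^sub>M i\<in>{..<n}. borel)" by (simp add: Q_def)
  show "Q.indep_vars (\<lambda>_. borel) (\<lambda>i \<xi>. \<xi> i) {..<n}"
  \<comment> \<open>The characterisation by product laws is applied to nonempty index sets, so the
    empty family is treated by itself.\<close>
  proof (cases "n = 0")
    case True
    then show ?thesis
      unfolding Q.indep_vars_def2 by (auto simp: Q.indep_sets_def)
  next
    case False
    then have ne: "{..<n} \<noteq> {}" by auto
    have "distr Q (\<Pi>\<^sub>M i\<in>{..<n}. borel) (\<lambda>x. \<lambda>i\<in>{..<n}. x i) = distr Q Q (\<lambda>x. x)"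
      by (intro distr_cong) (auto simp: Q_def space_PiM)
    also have "\<dots> = Q" by (simp add: distr_id2)
    also have "\<dots> = (\<Pi>\<^sub>M i\<in>{..<n}. distr M borel (X i))"
      unfolding Q_def using ind by (subst (asm) indep_vars_iff_distr_eq_PiM'[OF ne]) auto
    also have "\<dots> = (\<Pi>\<^sub>M i\<in>{..<n}. distr Q borel (\<lambda>\<xi>. \<xi> i))"
      by (intro PiM_cong refl) (auto simp: Q_def distr_distr comp_def intro!: distr_cong)
    finally show ?thesis
      by (subst Q.indep_vars_iff_distr_eq_PiM'[OF ne]) auto
  qed
qed

text \<open>The moments on both sides depend on the joint law alone. This makes the inequalities on
  \<open>nat \<Rightarrow> real\<close> available on any probability space.\<close>

lemma mz_family_exists:
  fixes X :: "nat \<Rightarrow> 'a \<Rightarrow> real"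
  assumes q: "1 \<le> q" and ind: "indep_vars (\<lambda>_. borel) X {..<n}"
    and Xq: "\<And>j. j < n \<Longrightarrow> integrable M (\<lambda>x. \<bar>X j x\<bar> powr q)"
    and X0: "\<And>j. j < n \<Longrightarrow> expectation (X j) = 0"
  obtains Q f where "mz_family q Q n f"
    "mz_lhs q Q n f = expectation (\<lambda>x. \<bar>\<Sum>j<n. X j x\<bar> powr q) powr (1 / q)"
    "mz_rhs q Q n f = expectation (\<lambda>x. (\<Sum>j<n. (X j x)\<^sup>2) powr (q / 2)) powr (1 / q)"
proof -
  have [measurable]: "\<And>i. i < n \<Longrightarrow> X i \<in> borel_measurable M"
    using ind by (auto simp: indep_vars_def)
  have X1: "integrable M (X j)" if "j < n" for j
    using q _ Xq[OF that] by (rule integrable_of_abs_powr) (use that in measurable)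
  define Q where "Q = distr M (\<Pi>\<^sub>M i\<in>{..<n}. borel) (\<lambda>x. \<lambda>i\<in>{..<n}. X i x)"
  let ?f = "\<lambda>i (\<xi> :: nat \<Rightarrow> real). \<xi> i"
  have T [measurable]: "(\<lambda>x. \<lambda>i\<in>{..<n}. X i x) \<in> measurable M (\<Pi>\<^sub>M i\<in>{..<n}. borel)"
    by measurable
  have mean: "(\<integral>\<xi>. \<xi> j \<partial>Q) = 0" if "j < n" for j
    unfolding Q_def using that X0[OF that] by (subst integral_distr) auto
  have fam: "mz_family q Q n ?f"
    unfolding mz_family_def using indep_vars_coordinates[OF ind] X1 Xq
    by (auto simp: Q_def integrable_distr_eq)
  have "mz_lhs q Q n ?f = (\<integral>\<xi>. \<bar>\<Sum>j<n. \<xi> j\<bar> powr q \<partial>Q) powr (1 / q)"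
    unfolding mz_lhs_def using mean by simp
  also have "(\<integral>\<xi>. \<bar>\<Sum>j<n. \<xi> j\<bar> powr q \<partial>Q) = expectation (\<lambda>x. \<bar>\<Sum>j<n. X j x\<bar> powr q)"
    unfolding Q_def by (subst integral_distr) auto
  finally have L: "mz_lhs q Q n ?f = expectation (\<lambda>x. \<bar>\<Sum>j<n. X j x\<bar> powr q) powr (1 / q)" .
  have "mz_rhs q Q n ?f = (\<integral>\<xi>. (\<Sum>j<n. (\<xi> j)\<^sup>2) powr (q / 2) \<partial>Q) powr (1 / q)"
    unfolding mz_rhs_def using mean by simp
  also have "(\<integral>\<xi>. (\<Sum>j<n. (\<xi> j)\<^sup>2) powr (q / 2) \<partial>Q) = expectation (\<lambda>x. (\<Sum>j<n. (X j x)\<^sup>2) powr (q / 2))"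
    unfolding Q_def by (subst integral_distr) auto
  finally have R: "mz_rhs q Q n ?f = expectation (\<lambda>x. (\<Sum>j<n. (X j x)\<^sup>2) powr (q / 2)) powr (1 / q)" .
  show ?thesis using that[OF fam L R] .
qed

lemma indep_vars_singleton:
  assumes "X i \<in> measurable M (N i)"
  shows "indep_vars N X {i}"
  unfolding indep_vars_def2 indep_sets_def
proof (intro conjI ballI allI impI)
  fix J A assume J: "J \<subseteq> {i}" "J \<noteq> {}"
  then have "J = {i}" by auto
  then show "prob (\<Inter> (A ` J)) = (\<Prod>i\<in>J. prob (A i))" by simp
qed (use assms in \<open>auto intro: measurable_sets\<close>)

end

lemma mz_rademacher:
  assumes "1 \<le> q"
  obtains Q f where "mz_family q Q 1 f" "mz_lhs q Q 1 f = 1" "mz_rhs q Q 1 f = 1"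
proof -
  let ?P = "measure_pmf (bernoulli_pmf (1/2))"
  let ?X = "\<lambda>(j::nat) b. if b then 1 else - 1 :: real"
  have ind: "prob_space.indep_vars ?P (\<lambda>_. borel) ?X {..<1}"
  proof -
    have "prob_space.indep_vars ?P (\<lambda>_. borel) ?X {0}"
      by (rule measure_pmf.indep_vars_singleton) simp
    then show ?thesis by (simp add: lessThan_Suc)
  qed
  obtain Q f where "mz_family q Q 1 f"
    "mz_lhs q Q 1 f = measure_pmf.expectation (bernoulli_pmf (1/2)) (\<lambda>b. \<bar>\<Sum>j<1::nat. ?X j b\<bar> powr q) powr (1 / q)"
    "mz_rhs q Q 1 f = measure_pmf.expectation (bernoulli_pmf (1/2)) (\<lambda>b. (\<Sum>j<1::nat. (?X j b)\<^sup>2) powr (q / 2)) powr (1 / q)"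
  proof (rule measure_pmf.mz_family_exists[OF assms ind])
    show "integrable ?P (\<lambda>b. \<bar>?X j b\<bar> powr q)" for j
      by (intro integrable_measure_pmf_finite) simp
    show "measure_pmf.expectation (bernoulli_pmf (1/2)) (?X j) = 0" for j
      by simp
  qed
  moreover have "\<bar>if b then 1 else - 1 :: real\<bar> = 1" "(if b then 1 else - 1 :: real)\<^sup>2 = 1" for b
    by auto
  ultimately show ?thesis using that by (simp add: lessThan_Suc)
qed

lemma mz_lhs_nonneg [simp]: "0 \<le> mz_lhs q P n f" and mz_rhs_nonneg [simp]: "0 \<le> mz_rhs q P n f"
  by (simp_all add: mz_lhs_def mz_rhs_def)

lemma mz_upper_constant_exists:
  assumes q: "1 \<le> q"
  shows "\<exists>C. \<forall>P n f. mz_family q P n f \<longrightarrow> mz_lhs q P n f \<le> C * mz_rhs q P n f"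
proof -
  define K where "K = 2 powr (q + 1) * (2 * exp 1 * q powr q)"
  have "mz_lhs q P n f \<le> K powr (1 / q) * mz_rhs q P n f" if fam: "mz_family q P n f" for P n f
  proof -
    interpret prob_space P using fam by (simp add: mz_family_def)
    have ind: "indep_vars (\<lambda>_. borel) f {..<n}"
      and f1: "\<And>j. j < n \<Longrightarrow> integrable P (f j)"
      and fq: "\<And>j. j < n \<Longrightarrow> integrable P (\<lambda>x. \<bar>f j x\<bar> powr q)"
      using fam by (auto simp: mz_family_def)
    have [measurable]: "\<And>i. i < n \<Longrightarrow> f i \<in> borel_measurable P"
      using ind by (auto simp: indep_vars_def)
    \<comment> \<open>The constants refer to arbitrary families, while
      \<open>Marcinkiewicz_Zygmund_upper\<close> is stated for centred ones.\<close>
    define X where "X j x = f j x - expectation (f j)" for j x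
    have Xq: "integrable P (\<lambda>x. \<bar>X j x\<bar> powr q)" if j: "j < n" for j
    proof (rule Bochner_Integration.integrable_bound)
      show "integrable P (\<lambda>x. 2 powr q * (\<bar>f j x\<bar> powr q + \<bar>expectation (f j)\<bar> powr q))"
        using fq[OF j] by auto
      show "(\<lambda>x. \<bar>X j x\<bar> powr q) \<in> borel_measurable P"
        unfolding X_def using j by measurable
      have "\<bar>X j x\<bar> powr q \<le> 2 powr q * (\<bar>f j x\<bar> powr q + \<bar>expectation (f j)\<bar> powr q)" for x
        unfolding X_def using q by (intro order_trans[OF powr_mono2 powr_add_le]) auto
      then show "AE x in P. norm (\<bar>X j x\<bar> powr q)
          \<le> norm (2 powr q * (\<bar>f j x\<bar> powr q + \<bar>expectation (f j)\<bar> powr q))"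
        by (intro AE_I2) (auto intro: order_trans[OF _ abs_ge_self])
    qed
    have indX: "indep_vars (\<lambda>_. borel) X {..<n}"
      unfolding X_def by (rule indep_vars_compose2[OF ind]) auto
    have "expectation (\<lambda>x. \<bar>\<Sum>j<n. X j x\<bar> powr q)
        \<le> K * expectation (\<lambda>x. (\<Sum>j<n. (X j x)\<^sup>2) powr (q / 2))"
      unfolding K_def
    proof (rule Marcinkiewicz_Zygmund_upper[OF _ q indX])
      show "expectation (X j) = 0" if "j \<in> {..<n}" for j
        unfolding X_def using that f1 by (simp add: prob_space)
    qed (use Xq in auto)
    then have "expectation (\<lambda>x. \<bar>\<Sum>j<n. X j x\<bar> powr q) powr (1 / q)
        \<le> (K * expectation (\<lambda>x. (\<Sum>j<n. (X j x)\<^sup>2) powr (q / 2))) powr (1 / q)"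
      using q by (intro powr_mono2) auto
    then show ?thesis
      using q unfolding mz_lhs_def mz_rhs_def X_def[symmetric] power2_abs
      by (subst (asm) powr_mult) (auto simp: K_def)
  qed
  then show ?thesis by blast
qed

text \<open>A fair sign shows that the two sets of admissible constants are separated by \<open>1\<close>.\<close>
lemma MZ_A_nonneg:
  assumes q: "1 \<le> q"
  shows "0 \<le> MZ_A q"
proof -
  obtain Q f where Q: "mz_family q Q 1 f" "mz_lhs q Q 1 f = 1" "mz_rhs q Q 1 f = 1"
    using mz_rademacher[OF q] .
  show ?thesis
    unfolding MZ_A_def
  proof (rule cSup_upper)
    show "bdd_above {c. \<forall>P n f. mz_family q P n f \<longrightarrow> c * mz_rhs q P n f \<le> mz_lhs q P n f}"
      using Q by (intro bdd_aboveI[of _ 1]) force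
  qed simp
qed

text \<open>Besides monotonicity of powers, positivity ensures that \<open>MZ_B\<close> times an
  infinite right-hand side is infinite.\<close>

lemma MZ_B_ge_1:
  assumes q: "1 \<le> q"
  shows "1 \<le> MZ_B q"
proof -
  obtain Q f where Q: "mz_family q Q 1 f" "mz_lhs q Q 1 f = 1" "mz_rhs q Q 1 f = 1"
    using mz_rademacher[OF q] .
  show ?thesis
    unfolding MZ_B_def
    by (rule cInf_greatest) (use Q mz_upper_constant_exists[OF q] in force)+
qed

text \<open>Every admissible constant is at most the ratio of the two sides for this family, and
  therefore so is their supremum.\<close>

lemma MZ_A_le:
  assumes fam: "mz_family q P n f"
  shows "MZ_A q * mz_rhs q P n f \<le> mz_lhs q P n f"
proof (cases "mz_rhs q P n f = 0")
  case False
  then have pos: "0 < mz_rhs q P n f" by (simp add: less_le)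
  have "MZ_A q \<le> mz_lhs q P n f / mz_rhs q P n f"
    unfolding MZ_A_def
  proof (rule cSup_least)
    show "{c. \<forall>P n f. mz_family q P n f \<longrightarrow> c * mz_rhs q P n f \<le> mz_lhs q P n f} \<noteq> {}"
      by (auto intro!: exI[of _ 0])
  qed (use pos fam in \<open>auto simp: field_simps\<close>)
  then show ?thesis using pos by (simp add: field_simps)
qed simp

lemma MZ_B_ge:
  assumes q: "1 \<le> q" and fam: "mz_family q P n f"
  shows "mz_lhs q P n f \<le> MZ_B q * mz_rhs q P n f"
proof (cases "mz_rhs q P n f = 0")
  case True
  \<comment> \<open>There is no ratio to compare with here, but a single admissible constant already
    forces \<open>mz_lhs\<close> to vanish.\<close>
  then show ?thesis using mz_upper_constant_exists[OF q] fam by force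
next
  case False
  then have pos: "0 < mz_rhs q P n f" by (simp add: less_le)
  have "mz_lhs q P n f / mz_rhs q P n f \<le> MZ_B q"
    unfolding MZ_B_def
    by (rule cInf_greatest) (use pos fam mz_upper_constant_exists[OF q] in \<open>auto simp: field_simps\<close>)
  then show ?thesis using pos by (simp add: field_simps)
qed

section \<open>The inequalities for possibly infinite moments\<close>

context prob_space
begin

text \<open>If the larger side is infinite there is nothing to prove. If it is finite, every
  \<open>X j\<close> has a finite q-th moment: for finite \<open>R\<close> because |X j| is at most
  the square function, for finite \<open>L\<close> because \<open>X j\<close> is an independent
  summand of the whole sum. Then \<open>main\<close> applies.\<close>

lemma
  fixes X :: "nat \<Rightarrow> 'a \<Rightarrow> real"
  assumes q: "1 \<le> q" and ind: "indep_vars (\<lambda>_. borel) X {..<n}"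
    and X0: "\<And>j. j < n \<Longrightarrow> expectation (X j) = 0"
  defines "L \<equiv> (\<integral>\<^sup>+ x. ennreal (\<bar>\<Sum>j<n. X j x\<bar> powr q) \<partial>M)"
    and "R \<equiv> (\<integral>\<^sup>+ x. ennreal ((\<Sum>j<n. (X j x)\<^sup>2) powr (q / 2)) \<partial>M)"
  shows MZ_A_nn_integral: "ennreal (MZ_A q powr q) * R \<le> L"
    and MZ_B_nn_integral: "L \<le> ennreal (MZ_B q powr q) * R"
proof -
  have meas [measurable]: "\<And>i. i < n \<Longrightarrow> X i \<in> borel_measurable M"
    using ind by (auto simp: indep_vars_def)
  have main: "ennreal (MZ_A q powr q) * R \<le> L \<and> L \<le> ennreal (MZ_B q powr q) * R"
    if Xq: "\<And>j. j < n \<Longrightarrow> integrable M (\<lambda>x. \<bar>X j x\<bar> powr q)"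
  proof -
    define l where "l = expectation (\<lambda>x. \<bar>\<Sum>j<n. X j x\<bar> powr q)"
    define r where "r = expectation (\<lambda>x. (\<Sum>j<n. (X j x)\<^sup>2) powr (q / 2))"
    have lr: "0 \<le> l" "0 \<le> r" by (auto simp: l_def r_def)
    obtain Q f where Q: "mz_family q Q n f" "mz_lhs q Q n f = l powr (1 / q)"
      "mz_rhs q Q n f = r powr (1 / q)"
      unfolding l_def r_def using mz_family_exists[OF q ind Xq X0] by metis
    have "(MZ_A q * r powr (1 / q)) powr q \<le> (l powr (1 / q)) powr q"
      using MZ_A_le[OF Q(1)] Q MZ_A_nonneg[OF q] q by (intro powr_mono2) auto
    then have 1: "MZ_A q powr q * r \<le> l"
      using MZ_A_nonneg[OF q] q lr by (simp add: powr_mult powr_powr)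
    have "(l powr (1 / q)) powr q \<le> (MZ_B q * r powr (1 / q)) powr q"
      using MZ_B_ge[OF q Q(1)] Q q by (intro powr_mono2) auto
    then have 2: "l \<le> MZ_B q powr q * r"
      using MZ_B_ge_1[OF q] q lr by (simp add: powr_mult powr_powr)
    have "integrable M (\<lambda>x. \<bar>\<Sum>j<n. X j x\<bar> powr q)"
      by (rule integrable_dominated_sum[where A="{..<n}" and X=X, OF _ q]) (use Xq in auto)
    then have L: "L = ennreal l"
      unfolding L_def l_def by (intro nn_integral_eq_integral) auto
    have "integrable M (\<lambda>x. sqrt (\<Sum>j<n. (X j x)\<^sup>2) powr q)"
      by (rule integrable_dominated_sum[where A="{..<n}" and X=X, OF _ q])
        (use Xq L2_set_le_sum_abs[of "\<lambda>i. X i _" "{..<n}"] in \<open>auto simp: L2_set_def sum_nonneg\<close>)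
    then have "integrable M (\<lambda>x. (\<Sum>j<n. (X j x)\<^sup>2) powr (q / 2))"
      by (simp add: powr_half_sqrt[symmetric] powr_powr sum_nonneg)
    then have R: "R = ennreal r"
      unfolding R_def r_def by (intro nn_integral_eq_integral) auto
    show ?thesis
      unfolding L R using 1 2 lr by (simp add: ennreal_mult[symmetric] ennreal_leI)
  qed
  have fin_int: "integrable M (\<lambda>x. \<bar>X j x\<bar> powr q)"
    if "(\<integral>\<^sup>+ x. ennreal (\<bar>X j x\<bar> powr q) \<partial>M) < \<infinity>" "j < n" for j
    using that by (intro integrableI_bounded) auto
  show "ennreal (MZ_A q powr q) * R \<le> L"
  proof (cases "L < \<infinity>")
    case True
    have "integrable M (\<lambda>x. \<bar>X j x\<bar> powr q)" if j: "j < n" for j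
    proof (rule fin_int[OF _ j], rule finite_moment_of_indep_sum[OF q])
      \<comment> \<open>The whole sum is split into \<open>X j\<close> and the sum of all other
        terms.\<close>
      show "indep_var borel (X j) borel (\<lambda>x. \<Sum>i\<in>{..<n} - {j}. X i x)"
        using j ind by (intro indep_vars_sum) (auto simp: insert_absorb)
      have "X j x + (\<Sum>i\<in>{..<n} - {j}. X i x) = (\<Sum>i<n. X i x)" for x
        using j by (subst sum.remove[of "{..<n}" j]) auto
      then show "(\<integral>\<^sup>+ x. ennreal (\<bar>X j x + (\<Sum>i\<in>{..<n} - {j}. X i x)\<bar> powr q) \<partial>M) < \<infinity>"
        using True by (simp add: L_def)
    qed
    then show ?thesis using main by blast
  qed (simp add: less_top[symmetric])
  show "L \<le> ennreal (MZ_B q powr q) * R"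
  proof (cases "R < \<infinity>")
    case True
    have "integrable M (\<lambda>x. \<bar>X j x\<bar> powr q)" if j: "j < n" for j
    proof (rule fin_int[OF _ j])
      have "\<bar>X j x\<bar> powr q \<le> (\<Sum>i<n. (X i x)\<^sup>2) powr (q / 2)" for x
      proof -
        have "\<bar>X j x\<bar> powr q = ((X j x)\<^sup>2) powr (q / 2)"
        proof -
          have "(X j x)\<^sup>2 = \<bar>X j x\<bar> powr 2" by simp
          then show ?thesis by (simp only: powr_powr) simp
        qed
        also have "\<dots> \<le> (\<Sum>i<n. (X i x)\<^sup>2) powr (q / 2)"
          using q j by (intro powr_mono2 member_le_sum) auto
        finally show ?thesis .
      qed
      then have "(\<integral>\<^sup>+ x. ennreal (\<bar>X j x\<bar> powr q) \<partial>M) \<le> R"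
        unfolding R_def by (intro nn_integral_mono ennreal_leI)
      then show "(\<integral>\<^sup>+ x. ennreal (\<bar>X j x\<bar> powr q) \<partial>M) < \<infinity>"
        using True by (rule le_less_trans)
    qed
    then show ?thesis using main by blast
  next
    case False
    then show ?thesis
      using MZ_B_ge_1[OF q] by (auto simp: less_top[symmetric] ennreal_mult_top)
  qed
qed

end

section \<open>The quadrature error\<close>

context pair_sigma_finite
begin

lemma measurable_lqnorm_snd [measurable]:
  assumes q: "1 \<le> q" and F [measurable]: "F \<in> borel_measurable (M1 \<Otimes>\<^sub>M M2)"
  shows "(\<lambda>x. lqnorm M2 q (\<lambda>y. F (x, y))) \<in> borel_measurable M1"
  using q
proof (cases q rule: ereal_ge_1_cases)
  case (1 r)
  then show ?thesis unfolding 1 lqnorm_real by measurable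
next
  case 2
  \<comment> \<open>The section satisfies the bound \<open>t\<close> exactly when the section of {F
    > t} is null, that is, when an indicator has integral 0; this integral is measurable in x by
    Tonelli.\<close>
  have "{x\<in>space M1. esssup M2 (\<lambda>y. F (x, y)) \<le> t} \<in> sets M1" for t
  proof -
    have "esssup M2 (\<lambda>y. F (x, y)) \<le> t \<longleftrightarrow> (\<integral>\<^sup>+ y. indicator {w\<in>space (M1 \<Otimes>\<^sub>M M2). t < F w} (x, y) \<partial>M2) = 0"
      if x: "x \<in> space M1" for x
    proof -
      have [measurable]: "(\<lambda>y. F (x, y)) \<in> borel_measurable M2"
        using x by measurable
      have "esssup M2 (\<lambda>y. F (x, y)) \<le> t \<longleftrightarrow> (AE y in M2. F (x, y) \<le> t)"
        using esssup_AE[where M=M2 and f="\<lambda>y. F (x, y)"]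
        by (auto intro: esssup_I elim!: eventually_mono)
      also have "\<dots> \<longleftrightarrow> (AE y in M2. indicator {w\<in>space (M1 \<Otimes>\<^sub>M M2). t < F w} (x, y) = (0::ennreal))"
        using x by (intro AE_cong) (auto simp: space_pair_measure split: split_indicator)
      also have "\<dots> \<longleftrightarrow> (\<integral>\<^sup>+ y. indicator {w\<in>space (M1 \<Otimes>\<^sub>M M2). t < F w} (x, y) \<partial>M2) = 0"
        using x by (subst nn_integral_0_iff_AE) measurable
      finally show ?thesis .
    qed
    then have "{x\<in>space M1. esssup M2 (\<lambda>y. F (x, y)) \<le> t}
        = {x\<in>space M1. (\<integral>\<^sup>+ y. indicator {w\<in>space (M1 \<Otimes>\<^sub>M M2). t < F w} (x, y) \<partial>M2) = 0}"
      by auto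
    also have "\<dots> \<in> sets M1" by measurable
    finally show ?thesis .
  qed
  then show ?thesis unfolding 2 lqnorm_infty by (rule borel_measurableI_le)
qed

lemma lqnorm_pair_real:
  assumes r: "1 \<le> r" and F [measurable]: "F \<in> borel_measurable (M1 \<Otimes>\<^sub>M M2)"
  shows "lqnorm M1 (ereal r) (\<lambda>x. lqnorm M2 (ereal r) (\<lambda>y. F (x, y))) = lqnorm (M1 \<Otimes>\<^sub>M M2) (ereal r) F"
  using r by (simp add: lqnorm_real M2.nn_integral_fst[symmetric])

text \<open>For q = \<infinity> the reason is that the bound by the essential supremum on the
  product holds on almost every section.\<close>

lemma lqnorm_pair_le:
  assumes q: "1 \<le> q" and F [measurable]: "F \<in> borel_measurable (M1 \<Otimes>\<^sub>M M2)"
  shows "lqnorm M1 q (\<lambda>x. lqnorm M2 q (\<lambda>y. F (x, y))) \<le> lqnorm (M1 \<Otimes>\<^sub>M M2) q F"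
  using q
proof (cases q rule: ereal_ge_1_cases)
  case (1 r)
  then show ?thesis using lqnorm_pair_real[of r F] by simp
next
  case 2
  have "AE x in M1. AE y in M2. F (x, y) \<le> esssup (M1 \<Otimes>\<^sub>M M2) F"
    by (intro AE_pair esssup_AE)
  then have "AE x in M1. esssup M2 (\<lambda>y. F (x, y)) \<le> esssup (M1 \<Otimes>\<^sub>M M2) F"
  proof (rule AE_mp, intro AE_I2 impI)
    fix x assume "x \<in> space M1" "AE y in M2. F (x, y) \<le> esssup (M1 \<Otimes>\<^sub>M M2) F"
    then show "esssup M2 (\<lambda>y. F (x, y)) \<le> esssup (M1 \<Otimes>\<^sub>M M2) F"
      by (intro esssup_I) measurable
  qed
  then show ?thesis
    using measurable_lqnorm_snd[OF q F] unfolding 2 lqnorm_infty by (intro esssup_I)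
qed

end

lemma ennreal_inverse_antimono:
  assumes "a \<le> b"
  shows "inverse b \<le> inverse (a::ennreal)"
proof (cases "a = 0 \<or> b = top")
  case False
  then obtain x y where xy: "a = ennreal x" "b = ennreal y" "0 < x" "0 \<le> y"
    using assms by (cases a; cases b) (auto simp: less_le top_unique)
  then have "x \<le> y" using assms by simp
  then show ?thesis using xy by (simp add: inverse_ennreal ennreal_leI)
qed auto

lemma ennreal_divide_le_of_le_mult: "a \<le> k * b \<Longrightarrow> a / b \<le> (k::ennreal)"
proof -
  assume "a \<le> k * b"
  then have "a / b \<le> k * (b / b)"
    unfolding divide_ennreal_def by (metis mult.assoc mult_right_mono zero_le)
  \<comment> \<open>At 0 and at \<infinity> the quotient b / b is 0, so the bound covers the
    convention 0/0 = 0 used in \<open>errnorm\<close>.\<close>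
  also have "b / b \<le> 1"
    by (cases "b = 0"; cases "b = top") (auto simp: top.not_eq_extremum)
  then have "k * (b / b) \<le> k" using mult_left_mono[of "b / b" 1 k] by simp
  finally show ?thesis .
qed

text \<open>The exponent p is left out and fixed in a later context: the error kernel and its norm
  involve only q.\<close>

locale quadrature =
  fixes M :: "'a measure" and N :: nat and X :: "nat \<Rightarrow> 'a set" and \<omega> :: "nat \<Rightarrow> real"
    and q :: ereal and \<Phi> :: "'a \<Rightarrow> 'a \<Rightarrow> real"
  assumes X_sets: "\<And>j. j < N \<Longrightarrow> X j \<in> sets M"
    and X_disj: "disjoint_family_on X {..<N}"
    and X_union: "(\<Union>j<N. X j) = space M"
    and X_meas: "\<And>j. j < N \<Longrightarrow> emeasure M (X j) = ennreal (\<omega> j)"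
    and \<omega>_pos: "\<And>j. j < N \<Longrightarrow> \<omega> j > 0"
    and q_ge: "1 \<le> q"
    and \<Phi>_meas: "(\<lambda>(x, y). \<Phi> x y) \<in> borel_measurable (M \<Otimes>\<^sub>M M)"
    and \<Phi>_row: "\<And>x. x \<in> space M \<Longrightarrow> lqnorm M q (\<lambda>y. ennreal \<bar>\<Phi> x y\<bar>) < \<infinity>"
    and \<Phi>_col: "lqnorm M q (\<lambda>y. \<integral>\<^sup>+ x. ennreal \<bar>\<Phi> x y\<bar> \<partial>M) < \<infinity>"
begin

sublocale finite_measure M
proof
  have "emeasure M (space M) \<le> (\<Sum>j<N. emeasure M (X j))"
    unfolding X_union[symmetric] using X_sets by (intro emeasure_subadditive_finite) auto
  also have "\<dots> < \<infinity>" using X_meas by auto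
  finally show "emeasure M (space M) \<noteq> \<infinity>" by simp
qed

sublocale MM: pair_sigma_finite M M ..

abbreviation \<mu> :: "nat \<Rightarrow> 'a measure" where "\<mu> j \<equiv> piece M X \<omega> j"

abbreviation \<nu> :: "(nat \<Rightarrow> 'a) measure" where "\<nu> \<equiv> nodes_measure M N X \<omega>"

lemma X_subset: "j < N \<Longrightarrow> X j \<subseteq> space M"
  using X_sets sets.sets_into_space by blast

lemma measurable_Phi [measurable (raw)]:
  assumes "f \<in> measurable L M" "g \<in> measurable L M"
  shows "(\<lambda>w. \<Phi> (f w) (g w)) \<in> borel_measurable L"
  using measurable_compose[OF measurable_Pair[OF assms] \<Phi>_meas] by simp

lemma piece_eq_density: "\<mu> j = density (restrict_space M (X j)) (\<lambda>_. ennreal (1 / \<omega> j))"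
  unfolding piece_def
  by (intro measure_eqI) (auto simp: emeasure_density_const)

lemma space_piece: "j < N \<Longrightarrow> space (\<mu> j) = X j"
  using X_subset by (auto simp: piece_eq_density space_restrict_space)

lemma sets_piece [measurable_cong]: "sets (\<mu> j) = sets (restrict_space M (X j))"
  by (simp add: piece_eq_density)

lemma measurable_piece: "f \<in> measurable M L \<Longrightarrow> f \<in> measurable (\<mu> j) L"
  by (simp add: measurable_cong_sets[OF sets_piece refl] measurable_restrict_space1)

lemma integral_piece:
  fixes f :: "'a \<Rightarrow> real"
  assumes [measurable]: "f \<in> borel_measurable M" and j: "j < N"
  shows "(\<integral>x. f x \<partial>\<mu> j) = 1 / \<omega> j * (LINT x:X j|M. f x)"
proof -
  have "(\<integral>x. f x \<partial>\<mu> j) = (\<integral>x. 1 / \<omega> j * f x \<partial>restrict_space M (X j))"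
    unfolding piece_eq_density using \<omega>_pos[OF j]
    by (subst integral_density) (auto intro: measurable_restrict_space1)
  also have "\<dots> = 1 / \<omega> j * (LINT x:X j|M. f x)"
    using X_sets[OF j] X_subset[OF j]
    by (simp add: integral_restrict_space set_lebesgue_integral_def Int_absorb2)
  finally show ?thesis .
qed

lemma prob_space_piece: "j < N \<Longrightarrow> prob_space (\<mu> j)"
proof
  assume j: "j < N"
  have "emeasure (\<mu> j) (space (\<mu> j)) = ennreal (1 / \<omega> j) * emeasure M (X j)"
    using j X_sets[OF j] X_subset[OF j]
    by (simp add: space_piece) (simp add: piece_def emeasure_restrict_space)
  also have "\<dots> = 1"
    using \<omega>_pos[OF j] by (simp add: X_meas[OF j] ennreal_mult[symmetric])
  finally show "emeasure (\<mu> j) (space (\<mu> j)) = 1" .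
qed

sublocale nodes: prob_space \<nu>
  unfolding nodes_measure_def by (intro prob_space_PiM prob_space_piece) simp

sublocale \<nu>M: pair_sigma_finite \<nu> M ..

lemma space_nodes: "space \<nu> = (\<Pi>\<^sub>E j\<in>{..<N}. X j)"
  unfolding nodes_measure_def space_PiM by (rule PiE_cong) (simp add: space_piece)

lemma nodes_component: "xs \<in> space \<nu> \<Longrightarrow> j < N \<Longrightarrow> xs j \<in> X j"
  using PiE_mem[of xs "{..<N}" X j] by (simp add: space_nodes)

lemma nodes_component_space: "xs \<in> space \<nu> \<Longrightarrow> j < N \<Longrightarrow> xs j \<in> space M"
  using nodes_component[of xs j] X_subset[of j] by (meson subsetD)

lemma measurable_component_piece: "j < N \<Longrightarrow> (\<lambda>xs. xs j) \<in> measurable \<nu> (\<mu> j)"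
  unfolding nodes_measure_def by (intro measurable_component_singleton) simp

lemma measurable_component [measurable]: "j < N \<Longrightarrow> (\<lambda>xs. xs j) \<in> measurable \<nu> M"
  by (rule measurable_compose[OF measurable_component_piece measurable_piece[OF measurable_ident_sets[OF refl]]])

lemma distr_component: "j < N \<Longrightarrow> distr \<nu> (\<mu> j) (\<lambda>xs. xs j) = \<mu> j"
  unfolding nodes_measure_def by (rule distr_PiM_component) (simp_all add: prob_space_piece)

lemma indep_components: "nodes.indep_vars \<mu> (\<lambda>j xs. xs j) {..<N}"
proof (cases "N = 0")
  case True
  then show ?thesis unfolding nodes.indep_vars_def2 nodes.indep_sets_def by auto
next
  case False
  then have ne: "{..<N} \<noteq> {}" by auto
  have "distr \<nu> (\<Pi>\<^sub>M j\<in>{..<N}. \<mu> j) (\<lambda>xs. \<lambda>j\<in>{..<N}. xs j) = distr \<nu> \<nu> (\<lambda>xs. xs)"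
    by (intro distr_cong) (auto simp: nodes_measure_def space_PiM)
  also have "\<dots> = (\<Pi>\<^sub>M j\<in>{..<N}. \<mu> j)" by (simp add: distr_id2 nodes_measure_def)
  also have "\<dots> = (\<Pi>\<^sub>M j\<in>{..<N}. distr \<nu> (\<mu> j) (\<lambda>xs. xs j))"
    by (intro PiM_cong refl) (simp add: distr_component)
  finally show ?thesis
    by (subst nodes.indep_vars_iff_distr_eq_PiM'[OF ne]) (auto intro: measurable_component_piece)
qed

section \<open>The error kernel\<close>

abbreviation D :: "nat \<Rightarrow> 'a \<Rightarrow> 'a \<Rightarrow> real" where
  "D j \<equiv> dPhi M \<Phi> (X j)"

definition K :: "(nat \<Rightarrow> 'a) \<Rightarrow> 'a \<Rightarrow> real" where
  "K xs y = (\<Sum>j<N. D j (xs j) y)"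

lemma measurable_D_pair:
  assumes j: "j < N"
  shows "(\<lambda>(x, y). D j x y) \<in> borel_measurable (M \<Otimes>\<^sub>M M)"
proof -
  have [measurable]: "X j \<in> sets M" using X_sets[OF j] .
  show ?thesis unfolding dPhi_def set_lebesgue_integral_def by measurable
qed

lemma measurable_D [measurable (raw)]:
  assumes "j < N" "f \<in> measurable L M" "g \<in> measurable L M"
  shows "(\<lambda>w. D j (f w) (g w)) \<in> borel_measurable L"
  using measurable_compose[OF measurable_Pair[OF assms(2,3)] measurable_D_pair[OF assms(1)]] by simp

lemma measurable_K_pair [measurable]: "(\<lambda>(xs, y). K xs y) \<in> borel_measurable (\<nu> \<Otimes>\<^sub>M M)"
  unfolding K_def by measurable

lemma measurable_K: "xs \<in> space \<nu> \<Longrightarrow> K xs \<in> borel_measurable M"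
  unfolding K_def using nodes_component_space by measurable

abbreviation col :: "'a \<Rightarrow> ennreal" where
  "col y \<equiv> \<integral>\<^sup>+ z. ennreal \<bar>\<Phi> z y\<bar> \<partial>M"

lemma AE_col_finite: "AE y in M. col y < \<infinity>"
  by (intro lqnorm_finite_AE[OF q_ge _ \<Phi>_col]) measurable

lemma integrable_col: "y \<in> space M \<Longrightarrow> col y < \<infinity> \<Longrightarrow> integrable M (\<lambda>z. \<Phi> z y)"
  by (intro integrableI_bounded) auto

text \<open>Separating the integral of the difference requires an integrable section, hence the
  restriction to points with finite \<open>col y\<close>; by \<open>AE_col_finite\<close> this is
  almost every \<open>y\<close>.\<close>

lemma D_eq:
  assumes y: "y \<in> space M" "col y < \<infinity>" and j: "j < N"
  shows "D j x y = \<omega> j * \<Phi> x y - (LINT z:X j|M. \<Phi> z y)"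
proof -
  have "set_integrable M (X j) (\<lambda>z. \<Phi> z y)"
    unfolding set_integrable_def using integrable_col[OF y] X_sets[OF j]
    by (intro integrable_mult_indicator)
  moreover have "set_integrable M (X j) (\<lambda>z. \<Phi> x y)"
    unfolding set_integrable_def using X_sets[OF j] by (intro integrable_mult_indicator) auto
  moreover have "measure M (X j) = \<omega> j"
    using X_meas[OF j] \<omega>_pos[OF j] by (simp add: measure_def)
  ultimately show ?thesis
    unfolding dPhi_def using X_sets[OF j]
    by (subst set_integral_diff) (auto simp: set_integral_const emeasure_eq_measure)
qed

text \<open>The pieces partition the space, so their integrals reassemble. Thus
  \<open>K xs y\<close> is the quadrature error of the section
  \<open>\<lambda>z. \<Phi> z y\<close>.\<close>

lemma K_eq:
  assumes y: "y \<in> space M" "col y < \<infinity>"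
  shows "K xs y = (\<Sum>j<N. \<omega> j * \<Phi> (xs j) y) - (\<integral>z. \<Phi> z y \<partial>M)"
proof -
  have int: "set_integrable M (X j) (\<lambda>z. \<Phi> z y)" if "j < N" for j
    unfolding set_integrable_def using integrable_col[OF y] X_sets[OF that]
    by (intro integrable_mult_indicator)
  have "(\<integral>z. \<Phi> z y \<partial>M) = (LINT z:(\<Union>j<N. X j)|M. \<Phi> z y)"
    unfolding X_union set_lebesgue_integral_def by (intro Bochner_Integration.integral_cong) auto
  also have "\<dots> = (\<Sum>j<N. LINT z:X j|M. \<Phi> z y)"
    using int X_sets X_disj by (intro set_integral_finite_Union) auto
  finally show ?thesis
    unfolding K_def by (simp add: D_eq[OF y] sum_subtractf)
qed

text \<open>Minkowski's inequality bounds the kernel by the rows at the nodes plus the column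
  integral. Finiteness holds at every choice of nodes and is what \<open>lqnorm_duality\<close> asks
  for.\<close>

lemma K_norm_finite:
  assumes xs: "xs \<in> space \<nu>"
  shows "lqnorm M q (\<lambda>y. ennreal \<bar>K xs y\<bar>) < \<infinity>"
proof -
  note [measurable] = measurable_K[OF xs]
  have row [measurable]: "j < N \<Longrightarrow> (\<lambda>y. \<Phi> (xs j) y) \<in> borel_measurable M" for j
    using nodes_component_space[OF xs, of j] by measurable
  have "lqnorm M q (\<lambda>y. ennreal \<bar>K xs y\<bar>)
      \<le> lqnorm M q (\<lambda>y. (\<Sum>j<N. ennreal (\<omega> j) * ennreal \<bar>\<Phi> (xs j) y\<bar>) + col y)"
  proof (rule lqnorm_mono_AE[OF q_ge])
    show "AE y in M. ennreal \<bar>K xs y\<bar> \<le> (\<Sum>j<N. ennreal (\<omega> j) * ennreal \<bar>\<Phi> (xs j) y\<bar>) + col y"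
      using AE_col_finite AE_space
    proof eventually_elim
      case (elim y)
      have "\<bar>K xs y\<bar> \<le> (\<Sum>j<N. \<omega> j * \<bar>\<Phi> (xs j) y\<bar>) + \<bar>\<integral>z. \<Phi> z y \<partial>M\<bar>"
        unfolding K_eq[OF elim(2,1)]
        by (rule order_trans[OF abs_triangle_ineq4 add_right_mono[OF order_trans[OF sum_abs sum_mono]]])
          (auto simp: abs_mult abs_of_pos[OF \<omega>_pos])
      then have "ennreal \<bar>K xs y\<bar> \<le> ennreal (\<Sum>j<N. \<omega> j * \<bar>\<Phi> (xs j) y\<bar>) + ennreal \<bar>\<integral>z. \<Phi> z y \<partial>M\<bar>"
        using \<omega>_pos by (subst ennreal_plus[symmetric]) (auto intro!: ennreal_leI sum_nonneg mult_nonneg_nonneg simp: less_imp_le)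
      also have "ennreal \<bar>\<integral>z. \<Phi> z y \<partial>M\<bar> \<le> col y"
        using integral_norm_bound_ennreal[OF integrable_col[OF elim(2,1)]] by simp
      also have "ennreal (\<Sum>j<N. \<omega> j * \<bar>\<Phi> (xs j) y\<bar>) = (\<Sum>j<N. ennreal (\<omega> j) * ennreal \<bar>\<Phi> (xs j) y\<bar>)"
        using \<omega>_pos by (subst sum_ennreal[symmetric]) (auto simp: less_imp_le ennreal_mult)
      finally show ?case by simp
    qed
  qed measurable
  also have "\<dots> \<le> lqnorm M q (\<lambda>y. \<Sum>j<N. ennreal (\<omega> j) * ennreal \<bar>\<Phi> (xs j) y\<bar>) + lqnorm M q col"
    by (intro lqnorm_add q_ge) measurable
  also have "\<dots> \<le> (\<Sum>j<N. lqnorm M q (\<lambda>y. ennreal (\<omega> j) * ennreal \<bar>\<Phi> (xs j) y\<bar>)) + lqnorm M q col"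
    by (intro add_right_mono lqnorm_sum q_ge) auto
  also have "\<dots> \<le> (\<Sum>j<N. ennreal (\<omega> j) * lqnorm M q (\<lambda>y. ennreal \<bar>\<Phi> (xs j) y\<bar>)) + lqnorm M q col"
    by (intro add_right_mono sum_mono lqnorm_cmult_le q_ge) auto
  also have "\<dots> < \<infinity>"
    using \<Phi>_row \<Phi>_col nodes_component_space[OF xs]
    by (auto simp: ennreal_mult_less_top)
  finally show ?thesis .
qed

section \<open>Potentials, duality and the norm of the error functional\<close>

context
  fixes p :: ereal
  assumes p_ge: "1 \<le> p" and pq: "1 / p + 1 / q = 1"
begin

lemma row_integrable:
  assumes g: "in_Lp M p g" and x: "x \<in> space M"
  shows "integrable M (\<lambda>y. \<Phi> x y * g y)"
proof (rule integrableI_bounded)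
  have [measurable]: "g \<in> borel_measurable M" using g by (simp add: in_Lp_def)
  show "(\<lambda>y. \<Phi> x y * g y) \<in> borel_measurable M" using x by measurable
  have "(\<integral>\<^sup>+ y. ennreal (norm (\<Phi> x y * g y)) \<partial>M) = (\<integral>\<^sup>+ y. ennreal \<bar>g y\<bar> * ennreal \<bar>\<Phi> x y\<bar> \<partial>M)"
    by (intro nn_integral_cong) (simp add: abs_mult ennreal_mult mult.commute)
  also have "\<dots> \<le> lqnorm M p (\<lambda>y. ennreal \<bar>g y\<bar>) * lqnorm M q (\<lambda>y. ennreal \<bar>\<Phi> x y\<bar>)"
    using x by (intro Hoelder p_ge q_ge pq) measurable
  also have "\<dots> < \<infinity>"
    using g \<Phi>_row[OF x] by (auto simp: in_Lp_def ennreal_mult_less_top)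
  finally show "(\<integral>\<^sup>+ y. ennreal (norm (\<Phi> x y * g y)) \<partial>M) < \<infinity>" .
qed

text \<open>With \<open>y\<close> as the outer variable the inner integral is |g y| *
  \<open>col y\<close>, so Hoelder's inequality and the column condition give the absolute
  integrability needed for Fubini.\<close>

lemma kernel_integrable:
  assumes g: "in_Lp M p g"
  shows "integrable (M \<Otimes>\<^sub>M M) (\<lambda>(x, y). \<Phi> x y * g y)"
proof (rule integrableI_bounded)
  have [measurable]: "g \<in> borel_measurable M" using g by (simp add: in_Lp_def)
  show "(\<lambda>(x, y). \<Phi> x y * g y) \<in> borel_measurable (M \<Otimes>\<^sub>M M)" by measurable
  have "(\<integral>\<^sup>+ w. ennreal (norm (case w of (x, y) \<Rightarrow> \<Phi> x y * g y)) \<partial>(M \<Otimes>\<^sub>M M))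
      = (\<integral>\<^sup>+ w. ennreal \<bar>g (snd w)\<bar> * ennreal \<bar>\<Phi> (fst w) (snd w)\<bar> \<partial>(M \<Otimes>\<^sub>M M))"
    by (intro nn_integral_cong) (simp add: split_beta abs_mult ennreal_mult mult.commute)
  also have "\<dots> = (\<integral>\<^sup>+ y. \<integral>\<^sup>+ x. ennreal \<bar>g y\<bar> * ennreal \<bar>\<Phi> x y\<bar> \<partial>M \<partial>M)"
    by (subst MM.nn_integral_snd[symmetric]) auto
  also have "\<dots> = (\<integral>\<^sup>+ y. ennreal \<bar>g y\<bar> * col y \<partial>M)"
    by (intro nn_integral_cong nn_integral_cmult) measurable
  also have "\<dots> \<le> lqnorm M p (\<lambda>y. ennreal \<bar>g y\<bar>) * lqnorm M q col"
    by (intro Hoelder p_ge q_ge pq) measurable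
  also have "\<dots> < \<infinity>"
    using g \<Phi>_col by (auto simp: in_Lp_def ennreal_mult_less_top)
  finally show "(\<integral>\<^sup>+ w. ennreal (norm (case w of (x, y) \<Rightarrow> \<Phi> x y * g y)) \<partial>(M \<Otimes>\<^sub>M M)) < \<infinity>" .
qed

lemma qerr_eq:
  assumes xs: "xs \<in> space \<nu>" and g: "in_Lp M p g" and f: "represents M \<Phi> g f"
  shows "qerr M N \<omega> xs f = (\<integral>y. K xs y * g y \<partial>M)"
proof -
  note [measurable] = measurable_K[OF xs]
  have [measurable]: "g \<in> borel_measurable M" using g by (simp add: in_Lp_def)
  have [measurable]: "j < N \<Longrightarrow> (\<lambda>y. \<Phi> (xs j) y) \<in> borel_measurable M" for j
    using nodes_component_space[OF xs, of j] by measurable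
  have row: "integrable M (\<lambda>y. \<Phi> (xs j) y * g y)" if "j < N" for j
    using that by (intro row_integrable g nodes_component_space xs)
  have "(\<integral>x. f x \<partial>M) = (\<integral>x. \<integral>y. \<Phi> x y * g y \<partial>M \<partial>M)"
    using f by (intro Bochner_Integration.integral_cong) (auto simp: represents_def)
  also have "\<dots> = (\<integral>y. \<integral>x. \<Phi> x y * g y \<partial>M \<partial>M)"
    by (rule MM.Fubini_integral[symmetric]) (rule kernel_integrable[OF g])
  finally have 1: "(\<integral>x. f x \<partial>M) = (\<integral>y. (\<integral>x. \<Phi> x y \<partial>M) * g y \<partial>M)" by simp
  have int1: "integrable M (\<lambda>y. (\<integral>x. \<Phi> x y \<partial>M) * g y)"
    using MM.integrable_snd[OF kernel_integrable[OF g]] by simp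
  have "(\<Sum>j<N. \<omega> j * f (xs j)) = (\<Sum>j<N. \<integral>y. \<omega> j * (\<Phi> (xs j) y * g y) \<partial>M)"
    using f nodes_component_space[OF xs] by (simp add: represents_def)
  also have "\<dots> = (\<integral>y. (\<Sum>j<N. \<omega> j * (\<Phi> (xs j) y * g y)) \<partial>M)"
    using row by (subst Bochner_Integration.integral_sum) auto
  finally have 2: "(\<Sum>j<N. \<omega> j * f (xs j)) = (\<integral>y. (\<Sum>j<N. \<omega> j * (\<Phi> (xs j) y * g y)) \<partial>M)" .
  have "qerr M N \<omega> xs f = (\<integral>y. (\<Sum>j<N. \<omega> j * (\<Phi> (xs j) y * g y)) - (\<integral>x. \<Phi> x y \<partial>M) * g y \<partial>M)"
    unfolding qerr_def 1 2 using row int1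
    by (intro Bochner_Integration.integral_diff[symmetric]) auto
  also have "\<dots> = (\<integral>y. K xs y * g y \<partial>M)"
  \<comment> \<open>The formula \<open>K_eq\<close> is available only where the column is finite,
    hence almost everywhere.\<close>
  proof (rule integral_cong_AE)
    show "AE y in M. (\<Sum>j<N. \<omega> j * (\<Phi> (xs j) y * g y)) - (\<integral>x. \<Phi> x y \<partial>M) * g y = K xs y * g y"
      using AE_col_finite AE_space
      by eventually_elim (simp add: K_eq left_diff_distrib sum_distrib_right mult.assoc)
  qed measurable
  finally show ?thesis .
qed

lemma qerr_le:
  assumes xs: "xs \<in> space \<nu>" and f: "f \<in> Hspace M \<Phi> p"
  shows "ennreal \<bar>qerr M N \<omega> xs f\<bar> \<le> lqnorm M q (\<lambda>y. ennreal \<bar>K xs y\<bar>) * Hnorm M \<Phi> p f"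
proof -
  define k where "k = lqnorm M q (\<lambda>y. ennreal \<bar>K xs y\<bar>)"
  note [measurable] = measurable_K[OF xs]
  have bound: "ennreal \<bar>qerr M N \<omega> xs f\<bar> \<le> k * lqnorm M p (\<lambda>y. ennreal \<bar>g y\<bar>)"
    if g: "in_Lp M p g" "represents M \<Phi> g f" for g
  proof -
    have [measurable]: "g \<in> borel_measurable M" using g by (simp add: in_Lp_def)
    have "ennreal \<bar>\<integral>y. K xs y * g y \<partial>M\<bar> \<le> (\<integral>\<^sup>+ y. ennreal (norm (K xs y * g y)) \<partial>M)"
      by (cases "integrable M (\<lambda>y. K xs y * g y)")
        (use integral_norm_bound_ennreal[of M "\<lambda>y. K xs y * g y"] in \<open>auto simp: not_integrable_integral_eq\<close>)
    also have "\<dots> = (\<integral>\<^sup>+ y. ennreal \<bar>g y\<bar> * ennreal \<bar>K xs y\<bar> \<partial>M)"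
      by (intro nn_integral_cong) (simp add: abs_mult ennreal_mult mult.commute)
    also have "\<dots> \<le> lqnorm M p (\<lambda>y. ennreal \<bar>g y\<bar>) * k"
      unfolding k_def by (intro Hoelder p_ge q_ge pq) measurable
    finally show ?thesis by (simp add: qerr_eq[OF xs g] mult.commute)
  qed
  have "k < \<infinity>" unfolding k_def by (rule K_norm_finite[OF xs])
  show ?thesis
  proof (cases "k = 0")
    case True
    obtain g where "in_Lp M p g" "represents M \<Phi> g f" using f by (auto simp: Hspace_def)
    from bound[OF this] True show ?thesis by simp
  next
    case False
    \<comment> \<open>Dividing by \<open>k\<close> moves it to the other side before the infimum
      over all representing functions is taken; multiplying back uses 0 < k < \<infinity>.\<close>
    have "ennreal \<bar>qerr M N \<omega> xs f\<bar> / k \<le> Hnorm M \<Phi> p f"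
      unfolding Hnorm_def
    proof (rule Inf_greatest)
      fix h assume "h \<in> {lqnorm M p (\<lambda>y. ennreal \<bar>g y\<bar>) |g. in_Lp M p g \<and> represents M \<Phi> g f}"
      then show "ennreal \<bar>qerr M N \<omega> xs f\<bar> / k \<le> h"
        using bound by (auto intro!: ennreal_divide_le_of_le_mult simp: mult.commute)
    qed
    then have "k * (ennreal \<bar>qerr M N \<omega> xs f\<bar> / k) \<le> k * Hnorm M \<Phi> p f"
      by (intro mult_left_mono) auto
    also have "k * (ennreal \<bar>qerr M N \<omega> xs f\<bar> / k) = ennreal \<bar>qerr M N \<omega> xs f\<bar>"
      using False \<open>k < \<infinity>\<close>
      by (subst ennreal_times_divide, subst mult.commute, subst mult_divide_eq_ennreal) auto
    finally show ?thesis by (simp add: k_def)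
  qed
qed

lemma errnorm_eq:
  assumes xs: "xs \<in> space \<nu>"
  shows "errnorm M \<Phi> p N \<omega> xs = lqnorm M q (\<lambda>y. ennreal \<bar>K xs y\<bar>)"
proof (rule antisym)
  show "errnorm M \<Phi> p N \<omega> xs \<le> lqnorm M q (\<lambda>y. ennreal \<bar>K xs y\<bar>)"
    unfolding errnorm_def
    by (intro SUP_least ennreal_divide_le_of_le_mult qerr_le xs)
  show "lqnorm M q (\<lambda>y. ennreal \<bar>K xs y\<bar>) \<le> errnorm M \<Phi> p N \<omega> xs"
  proof (rule dense_le)
    fix t assume t: "t < lqnorm M q (\<lambda>y. ennreal \<bar>K xs y\<bar>)"
    obtain g where g: "in_Lp M p g" "lqnorm M p (\<lambda>y. ennreal \<bar>g y\<bar>) \<noteq> 0"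
      "t * lqnorm M p (\<lambda>y. ennreal \<bar>g y\<bar>) \<le> ennreal (\<integral>y. K xs y * g y \<partial>M)"
      using lqnorm_duality[OF p_ge q_ge pq measurable_K[OF xs] K_norm_finite[OF xs] t] .
    define G where "G = lqnorm M p (\<lambda>y. ennreal \<bar>g y\<bar>)"
    have G: "G \<noteq> 0" "G < \<infinity>" using g by (auto simp: G_def in_Lp_def)
    define f where "f x = (\<integral>y. \<Phi> x y * g y \<partial>M)" for x
    have rep: "represents M \<Phi> g f" by (simp add: represents_def f_def)
    \<comment> \<open>Some other function representing \<open>f\<close> may have a smaller norm;
      replacing \<open>G\<close> by \<open>Hnorm\<close> then only enlarges the quotient.\<close>
    have H: "Hnorm M \<Phi> p f \<le> G"
      unfolding Hnorm_def G_def using g(1) rep by (intro Inf_lower) auto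
    have "t = t * (G / G)" using G by simp
    also have "\<dots> = t * G / G" by (simp add: ennreal_times_divide)
    also have "\<dots> \<le> ennreal \<bar>qerr M N \<omega> xs f\<bar> / G"
      using g(3) unfolding qerr_eq[OF xs g(1) rep] G_def
      by (intro divide_right_mono_ennreal) (auto intro: order_trans ennreal_leI)
    also have "\<dots> \<le> ennreal \<bar>qerr M N \<omega> xs f\<bar> / Hnorm M \<Phi> p f"
      unfolding divide_ennreal_def using H by (intro mult_left_mono ennreal_inverse_antimono) auto
    also have "\<dots> \<le> errnorm M \<Phi> p N \<omega> xs"
      unfolding errnorm_def using g(1) rep by (intro SUP_upper) (auto simp: Hspace_def)
    finally show "t \<le> errnorm M \<Phi> p N \<omega> xs" .
  qed
qed

text \<open>As a supremum over a possibly uncountable set of potentials, \<open>errnorm\<close> gets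
  its measurability from the formula \<open>errnorm_eq\<close>.\<close>

lemma measurable_errnorm: "errnorm M \<Phi> p N \<omega> \<in> borel_measurable \<nu>"
proof -
  have "(\<lambda>xs. lqnorm M q (\<lambda>y. (\<lambda>(xs, y). ennreal \<bar>K xs y\<bar>) (xs, y))) \<in> borel_measurable \<nu>"
    by (rule \<nu>M.measurable_lqnorm_snd[OF q_ge]) measurable
  then show ?thesis
    by (subst measurable_cong[OF errnorm_eq]) simp_all
qed

lemma exists_nodes:
  assumes C: "lqnorm \<nu> q (errnorm M \<Phi> p N \<omega>) \<le> C"
  shows "\<exists>xs. (\<forall>j<N. xs j \<in> X j) \<and> (\<forall>f\<in>Hspace M \<Phi> p.
    ennreal \<bar>(\<Sum>j<N. \<omega> j * f (xs j)) - (\<integral>x. f x \<partial>M)\<bar> \<le> C * Hnorm M \<Phi> p f)"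
proof -
  obtain xs where xs: "xs \<in> space \<nu>" "errnorm M \<Phi> p N \<omega> xs \<le> lqnorm \<nu> q (errnorm M \<Phi> p N \<omega>)"
    using nodes.exists_le_lqnorm[OF q_ge measurable_errnorm] by blast
  have "ennreal \<bar>(\<Sum>j<N. \<omega> j * f (xs j)) - (\<integral>x. f x \<partial>M)\<bar> \<le> C * Hnorm M \<Phi> p f"
    if "f \<in> Hspace M \<Phi> p" for f
    using qerr_le[OF xs(1) that] xs(2) C unfolding errnorm_eq[OF xs(1)] qerr_def
    by (meson mult_right_mono order_trans zero_le)
  then show ?thesis using nodes_component[OF xs(1)] by blast
qed

section \<open>The bounds by \<open>Gamma\<close> and \<open>Delta\<close>\<close>

lemma errnorm_le_Gamma: "lqnorm \<nu> q (errnorm M \<Phi> p N \<omega>) \<le> Gamma M \<Phi> q N X \<omega>"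
proof -
  have "lqnorm \<nu> q (errnorm M \<Phi> p N \<omega>) = lqnorm \<nu> q (\<lambda>xs. lqnorm M q (\<lambda>y. (\<lambda>(xs, y). ennreal \<bar>K xs y\<bar>) (xs, y)))"
    by (intro lqnorm_cong) (simp add: errnorm_eq)
  also have "\<dots> \<le> lqnorm (\<nu> \<Otimes>\<^sub>M M) q (\<lambda>(xs, y). ennreal \<bar>K xs y\<bar>)"
    by (intro \<nu>M.lqnorm_pair_le q_ge) measurable
  also have "\<dots> \<le> lqnorm (\<nu> \<Otimes>\<^sub>M M) q (\<lambda>w. \<Sum>j<N. ennreal \<bar>D j (fst w j) (snd w)\<bar>)"
  proof (intro lqnorm_mono_AE q_ge AE_I2)
    show "(case w of (xs, y) \<Rightarrow> ennreal \<bar>K xs y\<bar>) \<le> (\<Sum>j<N. ennreal \<bar>D j (fst w j) (snd w)\<bar>)" for w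
      unfolding K_def by (auto simp: split_beta sum_ennreal intro!: ennreal_leI)
  qed measurable
  also have "\<dots> \<le> (\<Sum>j<N. lqnorm (\<nu> \<Otimes>\<^sub>M M) q (\<lambda>w. ennreal \<bar>D j (fst w j) (snd w)\<bar>))"
    by (intro lqnorm_sum q_ge) auto
  also have "\<dots> = Gamma M \<Phi> q N X \<omega>"
    unfolding Gamma_def
  proof (intro sum.cong refl)
    fix j assume "j \<in> {..<N}"
    then have j: "j < N" by simp
    note [measurable] = measurable_component_piece[OF j] measurable_piece[of "\<lambda>x. x" M, simplified]
    have id: "distr M M (\<lambda>y. y) = M" by (simp add: distr_id2)
    \<comment> \<open>The j-th summand sees only the j-th node, so its norm may be computed on the
      image under (xs, y) to (xs j, y). The factor \<open>M\<close> is written as its own image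
      under the identity to obtain a product of image measures.\<close>
    have "\<mu> j \<Otimes>\<^sub>M M = distr \<nu> (\<mu> j) (\<lambda>xs. xs j) \<Otimes>\<^sub>M distr M M (\<lambda>y. y)"
      by (simp add: distr_component[OF j] id)
    also have "\<dots> = distr (\<nu> \<Otimes>\<^sub>M M) (\<mu> j \<Otimes>\<^sub>M M) (\<lambda>(xs, y). (xs j, y))"
      by (intro pair_measure_distr) (auto simp: id sigma_finite_measure_axioms)
    finally have eq: "\<mu> j \<Otimes>\<^sub>M M = distr (\<nu> \<Otimes>\<^sub>M M) (\<mu> j \<Otimes>\<^sub>M M) (\<lambda>(xs, y). (xs j, y))" .
    have "(\<lambda>w. D j (fst w) (snd w)) \<in> borel_measurable (\<mu> j \<Otimes>\<^sub>M M)"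
      using j by (intro measurable_D) (auto intro: measurable_compose[OF measurable_fst measurable_piece])
    then have D': "(\<lambda>(x, y). ennreal \<bar>D j x y\<bar>) \<in> borel_measurable (\<mu> j \<Otimes>\<^sub>M M)"
      by (simp add: split_beta')
    have "lqnorm (\<nu> \<Otimes>\<^sub>M M) q (\<lambda>w. ennreal \<bar>D j (fst w j) (snd w)\<bar>)
        = lqnorm (distr (\<nu> \<Otimes>\<^sub>M M) (\<mu> j \<Otimes>\<^sub>M M) (\<lambda>(xs, y). (xs j, y))) q (\<lambda>(x, y). ennreal \<bar>D j x y\<bar>)"
      by (subst lqnorm_distr[OF _ D' q_ge]) (auto simp: split_beta')
    then show "lqnorm (\<nu> \<Otimes>\<^sub>M M) q (\<lambda>w. ennreal \<bar>D j (fst w j) (snd w)\<bar>)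
        = lqnorm (\<mu> j \<Otimes>\<^sub>M M) q (\<lambda>(x, y). ennreal \<bar>D j x y\<bar>)"
      by (simp only: eq[symmetric])
  qed
  finally show ?thesis .
qed

lemma MZ_pointwise:
  assumes r: "1 \<le> r" and y: "y \<in> space M" "col y < \<infinity>"
  defines "L \<equiv> (\<integral>\<^sup>+ xs. ennreal (\<bar>K xs y\<bar> powr r) \<partial>\<nu>)"
    and "R \<equiv> (\<integral>\<^sup>+ xs. ennreal ((\<Sum>j<N. (D j (xs j) y)\<^sup>2) powr (r / 2)) \<partial>\<nu>)"
  shows "ennreal (MZ_A r powr r) * R \<le> L" "L \<le> ennreal (MZ_B r powr r) * R"
proof -
  have ind: "nodes.indep_vars (\<lambda>_. borel) (\<lambda>j xs. D j (xs j) y) {..<N}"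
    using y by (intro nodes.indep_vars_compose2[OF indep_components] measurable_piece measurable_D) auto
  have mean: "nodes.expectation (\<lambda>xs. D j (xs j) y) = 0" if j: "j < N" for j
  proof -
    have [measurable]: "(\<lambda>x. D j x y) \<in> borel_measurable M" using j y by measurable
    have "nodes.expectation (\<lambda>xs. D j (xs j) y) = (\<integral>x. D j x y \<partial>distr \<nu> (\<mu> j) (\<lambda>xs. xs j))"
      using j by (subst integral_distr) (auto intro: measurable_component_piece measurable_piece)
    also have "\<dots> = 1 / \<omega> j * (LINT x:X j|M. D j x y)"
      unfolding distr_component[OF j] using j by (intro integral_piece) auto
    \<comment> \<open>The difference \<Phi> x y - \<Phi> z y is antisymmetric in x and z, which both
      range over \<open>X j\<close>.\<close>
    also have "(LINT x:X j|M. D j x y) = 0"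
    proof -
      define c where "c = (LINT z:X j|M. \<Phi> z y)"
      have i1: "set_integrable M (X j) (\<lambda>z. \<Phi> z y)"
        unfolding set_integrable_def using integrable_col[OF y] X_sets[OF j]
        by (intro integrable_mult_indicator)
      have i2: "set_integrable M (X j) (\<lambda>z. c)"
        unfolding set_integrable_def using X_sets[OF j] by (intro integrable_mult_indicator) auto
      have m: "measure M (X j) = \<omega> j"
        using X_meas[OF j] \<omega>_pos[OF j] by (simp add: measure_def)
      have "(LINT x:X j|M. D j x y) = (LINT x:X j|M. \<omega> j * \<Phi> x y - c)"
        by (simp add: D_eq[OF y j] c_def)
      also have "\<dots> = \<omega> j * c - \<omega> j * c"
        using i1 i2 X_sets[OF j] m
        by (subst set_integral_diff) (auto simp: c_def set_integral_const emeasure_eq_measure)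
      finally show ?thesis by simp
    qed
    finally show ?thesis by simp
  qed
  show "ennreal (MZ_A r powr r) * R \<le> L" "L \<le> ennreal (MZ_B r powr r) * R"
    using nodes.MZ_A_nn_integral[OF r ind mean] nodes.MZ_B_nn_integral[OF r ind mean]
    by (simp_all add: L_def R_def K_def)
qed

lemma errnorm_Delta:
  assumes p: "1 < p"
  shows "ennreal (MZ_A (real_of_ereal q)) * Delta M \<Phi> q N X \<omega> \<le> lqnorm \<nu> q (errnorm M \<Phi> p N \<omega>)" (is ?lower)
    and "lqnorm \<nu> q (errnorm M \<Phi> p N \<omega>) \<le> ennreal (MZ_B (real_of_ereal q)) * Delta M \<Phi> q N X \<omega>" (is ?upper)
proof -
  \<comment> \<open>The assumption p > 1 excludes the conjugate pair (1, \<infinity>), so q is a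
    real exponent.\<close>
  obtain r where qr: "q = ereal r" and r: "1 \<le> r"
  proof (cases rule: conjugate_exponents_cases[OF p_ge q_ge pq])
    case (1 a b)
    then show ?thesis using that[of b] by simp
  next
    case 2
    then show ?thesis using p by simp
  next
    case 3
    then show ?thesis using that[of 1] by (simp add: one_ereal_def)
  qed
  \<comment> \<open>With \<open>y\<close> as the outer variable, \<open>MZ_pointwise\<close> can be
    integrated over almost every \<open>y\<close>; the root is taken only afterwards.\<close>
  define L where "L = (\<integral>\<^sup>+ y. \<integral>\<^sup>+ xs. ennreal (\<bar>K xs y\<bar> powr r) \<partial>\<nu> \<partial>M)"
  define R where "R = (\<integral>\<^sup>+ y. \<integral>\<^sup>+ xs. ennreal ((\<Sum>j<N. (D j (xs j) y)\<^sup>2) powr (r / 2)) \<partial>\<nu> \<partial>M)"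
  have "lqnorm \<nu> q (errnorm M \<Phi> p N \<omega>) = lqnorm \<nu> q (\<lambda>xs. lqnorm M q (\<lambda>y. (\<lambda>(xs, y). ennreal \<bar>K xs y\<bar>) (xs, y)))"
    by (intro lqnorm_cong) (simp add: errnorm_eq)
  also have "\<dots> = lqnorm (\<nu> \<Otimes>\<^sub>M M) q (\<lambda>(xs, y). ennreal \<bar>K xs y\<bar>)"
    unfolding qr by (intro \<nu>M.lqnorm_pair_real r) measurable
  also have "\<dots> = epow L (1 / r)"
    unfolding L_def qr lqnorm_real by (subst \<nu>M.nn_integral_snd[symmetric]) auto
  finally have L: "lqnorm \<nu> q (errnorm M \<Phi> p N \<omega>) = epow L (1 / r)" .
  have sq: "sqrt s powr r = s powr (r / 2)" if "0 \<le> s" for s :: real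
    using that by (simp add: powr_half_sqrt[symmetric] powr_powr)
  have D: "Delta M \<Phi> q N X \<omega> = epow R (1 / r)"
    unfolding R_def Delta_def qr lqnorm_real
    by (subst \<nu>M.nn_integral_snd[symmetric]) (auto simp: sum_nonneg sq)
  have cR: "c * R = (\<integral>\<^sup>+ y. c * (\<integral>\<^sup>+ xs. ennreal ((\<Sum>j<N. (D j (xs j) y)\<^sup>2) powr (r / 2)) \<partial>\<nu>) \<partial>M)" for c
    unfolding R_def by (rule nn_integral_cmult[symmetric]) measurable
  have A: "ennreal (MZ_A r powr r) * R \<le> L"
    unfolding cR L_def using AE_col_finite AE_space
    by (intro nn_integral_mono_AE, eventually_elim) (rule MZ_pointwise[OF r])
  have B: "L \<le> ennreal (MZ_B r powr r) * R"
    unfolding cR L_def using AE_col_finite AE_space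
    by (intro nn_integral_mono_AE, eventually_elim) (rule MZ_pointwise[OF r])
  have root: "epow (ennreal (c powr r) * R) (1 / r) = ennreal c * epow R (1 / r)" if "0 \<le> c" for c
    using that r by (simp add: epow_mult powr_powr)
  show ?lower
    unfolding L D using epow_mono[OF _ A, of "1 / r"] r MZ_A_nonneg[OF r] by (simp add: root qr)
  show ?upper
    unfolding L D using epow_mono[OF _ B, of "1 / r"] r MZ_B_ge_1[OF r] by (simp add: root qr)
qed

end

end

theorem theorem3:
  fixes M :: "'a measure" and N :: nat and X :: "nat \<Rightarrow> 'a set" and \<omega> :: "nat \<Rightarrow> real"
    and p q :: ereal and \<Phi> :: "'a \<Rightarrow> 'a \<Rightarrow> real"
  assumes X_sets: "\<And>j. j < N \<Longrightarrow> X j \<in> sets M"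
    and X_disj: "disjoint_family_on X {..<N}"
    and X_union: "(\<Union>j<N. X j) = space M"
    and X_meas: "\<And>j. j < N \<Longrightarrow> emeasure M (X j) = ennreal (\<omega> j)"
    and \<omega>_pos: "\<And>j. j < N \<Longrightarrow> \<omega> j > 0"
    and p_ge: "1 \<le> p" and q_ge: "1 \<le> q" and pq: "1 / p + 1 / q = 1"
    and \<Phi>_meas: "(\<lambda>(x, y). \<Phi> x y) \<in> borel_measurable (M \<Otimes>\<^sub>M M)"
    and \<Phi>_row: "\<And>x. x \<in> space M \<Longrightarrow> lqnorm M q (\<lambda>y. ennreal \<bar>\<Phi> x y\<bar>) < \<infinity>"
    and \<Phi>_col: "lqnorm M q (\<lambda>y. \<integral>\<^sup>+ x. ennreal \<bar>\<Phi> x y\<bar> \<partial>M) < \<infinity>"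
  shows "lqnorm (nodes_measure M N X \<omega>) q (errnorm M \<Phi> p N \<omega>) \<le> Gamma M \<Phi> q N X \<omega>
    \<and> (1 < p \<longrightarrow>
         ennreal (MZ_A (real_of_ereal q)) * Delta M \<Phi> q N X \<omega>
           \<le> lqnorm (nodes_measure M N X \<omega>) q (errnorm M \<Phi> p N \<omega>)
       \<and> lqnorm (nodes_measure M N X \<omega>) q (errnorm M \<Phi> p N \<omega>)
           \<le> ennreal (MZ_B (real_of_ereal q)) * Delta M \<Phi> q N X \<omega>)
    \<and> (\<exists>xs. (\<forall>j<N. xs j \<in> X j) \<and> (\<forall>f \<in> Hspace M \<Phi> p.
         ennreal \<bar>(\<Sum>j<N. \<omega> j * f (xs j)) - (\<integral>x. f x \<partial>M)\<bar> \<le> Gamma M \<Phi> q N X \<omega> * Hnorm M \<Phi> p f))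
    \<and> (1 < p \<longrightarrow> (\<exists>xs. (\<forall>j<N. xs j \<in> X j) \<and> (\<forall>f \<in> Hspace M \<Phi> p.
         ennreal \<bar>(\<Sum>j<N. \<omega> j * f (xs j)) - (\<integral>x. f x \<partial>M)\<bar>
           \<le> ennreal (MZ_B (real_of_ereal q)) * Delta M \<Phi> q N X \<omega> * Hnorm M \<Phi> p f)))"
proof -
  interpret quadrature M N X \<omega> q \<Phi>
    by (rule quadrature.intro) (assumption | rule assms)+
  note Gamma = errnorm_le_Gamma[OF p_ge pq] and Delta = errnorm_Delta[OF p_ge pq]
  show ?thesis
    by (intro conjI impI Gamma Delta exists_nodes[OF p_ge pq Gamma] exists_nodes[OF p_ge pq Delta(2)])
qed

end
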